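(* Let $\mathcal{E}$ be a category with finite products and small colimits, such that the functor $C\times(-):\mathcal{E}\to\mathcal{E}$ preserves colimits for every object $C\in\mathcal{E}$. Let $F:\mathcal{B}\to\mathcal{C}$ be any functor with $\mathcal{C}$ locally small, where the small category $\mathcal{B}$ has finite products that are preserved by the functor $X:\mathcal{B}\to\mathcal{E}$. Then the left Kan extension $\mathrm{Lan}_FX:\mathcal{C}\to\mathcal{E}$ also preserves finite products (i.e. all finite products that exist in $\mathcal{C}$).
   Context: The left Kan extension of $X$ along $F$ is the (pointwise) functor $\mathrm{Lan}_FX:\mathcal{C}\to\mathcal{E}$, $c\mapsto\mathrm{colim}\,(X V_{F,c})$, where $F/c$ is the comma category of pairs $(b,z)$ with $b\in\mathcal{B}$ and $z:Fb\to c$ in $\mathcal{C}$ (morphisms $f:(b,z)\to(b',z')$ being maps $f:b\to b'$ in $\mathcal{B}$ with $z'\cdot Ff=z$) and $V_{F,c}:F/c\to\mathcal{B}$, $(b,z)\mapsto b$, is the forgetful functor. Finite products include the empty product (terminal object). *)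

theory Defs
  imports Main
begin

unbundle cardinal_syntax

section \<open>Categories and functors\<close>

record ('o, 'm) cat =
  Ob   :: "'o set"
  Ar   :: "'m set"
  Dom  :: "'m \<Rightarrow> 'o"
  Cod  :: "'m \<Rightarrow> 'o"
  Idn  :: "'o \<Rightarrow> 'm"
  Comp :: "'m \<Rightarrow> 'm \<Rightarrow> 'm"  (* Comp C g f is the composite g after f *)

definition Hom :: "('o, 'm) cat \<Rightarrow> 'o \<Rightarrow> 'o \<Rightarrow> 'm set" where
  "Hom C a b = {f \<in> Ar C. Dom C f = a \<and> Cod C f = b}"

locale category =
  fixes C :: "('o, 'm) cat"
  assumes dom_in_Ob: "f \<in> Ar C \<Longrightarrow> Dom C f \<in> Ob C"
    and cod_in_Ob: "f \<in> Ar C \<Longrightarrow> Cod C f \<in> Ob C"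
    and id_in_Hom: "a \<in> Ob C \<Longrightarrow> Idn C a \<in> Hom C a a"
    and comp_in_Hom: "\<lbrakk>f \<in> Hom C a b; g \<in> Hom C b c\<rbrakk> \<Longrightarrow> Comp C g f \<in> Hom C a c"
    and comp_id_right: "f \<in> Hom C a b \<Longrightarrow> Comp C f (Idn C a) = f"
    and comp_id_left: "f \<in> Hom C a b \<Longrightarrow> Comp C (Idn C b) f = f"
    and comp_assoc: "\<lbrakk>f \<in> Hom C a b; g \<in> Hom C b c; h \<in> Hom C c d\<rbrakk>
      \<Longrightarrow> Comp C h (Comp C g f) = Comp C (Comp C h g) f"

text \<open>Maps of a functor are total functions; only their values on \<open>Ob\<close> and \<open>Ar\<close> of the
  source matter.\<close>

record ('o1, 'm1, 'o2, 'm2) fctr =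
  fob :: "'o1 \<Rightarrow> 'o2"
  far :: "'m1 \<Rightarrow> 'm2"

definition is_functor ::
  "('o1, 'm1) cat \<Rightarrow> ('o2, 'm2) cat \<Rightarrow> ('o1, 'm1, 'o2, 'm2) fctr \<Rightarrow> bool" where
  "is_functor C D F \<longleftrightarrow>
     (\<forall>a\<in>Ob C. fob F a \<in> Ob D) \<and>
     (\<forall>a\<in>Ob C. \<forall>b\<in>Ob C. \<forall>f\<in>Hom C a b. far F f \<in> Hom D (fob F a) (fob F b)) \<and>
     (\<forall>a\<in>Ob C. far F (Idn C a) = Idn D (fob F a)) \<and>
     (\<forall>a\<in>Ob C. \<forall>b\<in>Ob C. \<forall>c\<in>Ob C. \<forall>f\<in>Hom C a b. \<forall>g\<in>Hom C b c.
        far F (Comp C g f) = Comp D (far F g) (far F f))"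

definition fcomp ::
  "('o2, 'm2, 'o3, 'm3) fctr \<Rightarrow> ('o1, 'm1, 'o2, 'm2) fctr \<Rightarrow> ('o1, 'm1, 'o3, 'm3) fctr" where
  "fcomp G F = \<lparr>fob = fob G \<circ> fob F, far = far G \<circ> far F\<rparr>"


section \<open>Size\<close>

text \<open>Sizes are measured by a cardinal \<open>\<kappa>\<close> (in the theorem: an arbitrary infinite regular
  one): a set is small if its cardinality is below \<open>\<kappa>\<close>. For \<open>\<kappa>\<close> strongly inaccessible this
  is smallness relative to a Grothendieck universe.\<close>

definition small_cat :: "'u rel \<Rightarrow> ('o, 'm) cat \<Rightarrow> bool" where
  "small_cat \<kappa> C \<longleftrightarrow> |Ob C| <o \<kappa> \<and> |Ar C| <o \<kappa>"

definition locally_small_cat :: "'u rel \<Rightarrow> ('o, 'm) cat \<Rightarrow> bool" where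
  "locally_small_cat \<kappa> C \<longleftrightarrow> (\<forall>a\<in>Ob C. \<forall>b\<in>Ob C. |Hom C a b| <o \<kappa> )"


section \<open>Colimits\<close>

definition is_cocone ::
  "('j, 'k) cat \<Rightarrow> ('o, 'm) cat \<Rightarrow> ('j, 'k, 'o, 'm) fctr \<Rightarrow> 'o \<Rightarrow> ('j \<Rightarrow> 'm) \<Rightarrow> bool" where
  "is_cocone J E D Q \<iota> \<longleftrightarrow>
     Q \<in> Ob E \<and>
     (\<forall>j\<in>Ob J. \<iota> j \<in> Hom E (fob D j) Q) \<and>
     (\<forall>u\<in>Ar J. Comp E (\<iota> (Cod J u)) (far D u) = \<iota> (Dom J u))"

definition is_colimit ::
  "('j, 'k) cat \<Rightarrow> ('o, 'm) cat \<Rightarrow> ('j, 'k, 'o, 'm) fctr \<Rightarrow> 'o \<Rightarrow> ('j \<Rightarrow> 'm) \<Rightarrow> bool" where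
  "is_colimit J E D Q \<iota> \<longleftrightarrow>
     is_cocone J E D Q \<iota> \<and>
     (\<forall>Q' \<iota>'. is_cocone J E D Q' \<iota>' \<longrightarrow>
        (\<exists>!h. h \<in> Hom E Q Q' \<and> (\<forall>j\<in>Ob J. Comp E h (\<iota> j) = \<iota>' j)))"

text \<open>Diagram shapes range over categories whose objects and arrows are taken from the type
  underlying \<open>\<kappa>\<close>. As every set of cardinality below \<open>\<kappa>\<close> injects into \<open>Field \<kappa>\<close>, every small
  category, on whatever types, is isomorphic to one of these.\<close>

definition has_small_colimits :: "'u rel \<Rightarrow> ('o, 'm) cat \<Rightarrow> bool" where
  "has_small_colimits \<kappa> E \<longleftrightarrow>
     (\<forall>(J :: ('u, 'u) cat) D. category J \<and> small_cat \<kappa> J \<and> is_functor J E D \<longrightarrow>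
        (\<exists>Q \<iota>. is_colimit J E D Q \<iota>))"

definition preserves_small_colimits ::
  "'u rel \<Rightarrow> ('o1, 'm1) cat \<Rightarrow> ('o2, 'm2) cat \<Rightarrow> ('o1, 'm1, 'o2, 'm2) fctr \<Rightarrow> bool" where
  "preserves_small_colimits \<kappa> A E T \<longleftrightarrow>
     (\<forall>(J :: ('u, 'u) cat) D Q \<iota>.
        category J \<and> small_cat \<kappa> J \<and> is_functor J A D \<and> is_colimit J A D Q \<iota> \<longrightarrow>
        is_colimit J E (fcomp T D) (fob T Q) (\<lambda>j. far T (\<iota> j)))"


section \<open>Products\<close>

definition is_product ::
  "('o, 'm) cat \<Rightarrow> 'i set \<Rightarrow> ('i \<Rightarrow> 'o) \<Rightarrow> 'o \<Rightarrow> ('i \<Rightarrow> 'm) \<Rightarrow> bool" where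
  "is_product E I A P \<pi> \<longleftrightarrow>
     P \<in> Ob E \<and>
     (\<forall>i\<in>I. \<pi> i \<in> Hom E P (A i)) \<and>
     (\<forall>Y\<in>Ob E. \<forall>f. (\<forall>i\<in>I. f i \<in> Hom E Y (A i)) \<longrightarrow>
        (\<exists>!h. h \<in> Hom E Y P \<and> (\<forall>i\<in>I. Comp E (\<pi> i) h = f i)))"

text \<open>The case \<open>n = 0\<close> is the terminal object.\<close>

definition has_finite_products :: "('o, 'm) cat \<Rightarrow> bool" where
  "has_finite_products E \<longleftrightarrow>
     (\<forall>(n :: nat) A. (\<forall>i<n. A i \<in> Ob E) \<longrightarrow> (\<exists>P \<pi>. is_product E {..<n} A P \<pi>))"

text \<open>Preservation of all finite products that exist in the source; the source is not required
  to have finite products.\<close>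

definition preserves_finite_products ::
  "('o1, 'm1) cat \<Rightarrow> ('o2, 'm2) cat \<Rightarrow> ('o1, 'm1, 'o2, 'm2) fctr \<Rightarrow> bool" where
  "preserves_finite_products C E L \<longleftrightarrow>
     (\<forall>(n :: nat) A P \<pi>. is_product C {..<n} A P \<pi> \<longrightarrow>
        is_product E {..<n} (\<lambda>i. fob L (A i)) (fob L P) (\<lambda>i. far L (\<pi> i)))"

text \<open>\<open>T\<close> is the functor \<open>c \<times> (-)\<close> for a choice of binary products with projections
  \<open>p d : T d \<rightarrow> c\<close> and \<open>q d : T d \<rightarrow> d\<close>; it acts on arrows as \<open>id \<times> f\<close>.\<close>

definition is_product_functor ::
  "('o, 'm) cat \<Rightarrow> 'o \<Rightarrow> ('o, 'm, 'o, 'm) fctr \<Rightarrow> ('o \<Rightarrow> 'm) \<Rightarrow> ('o \<Rightarrow> 'm) \<Rightarrow> bool" where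
  "is_product_functor E c T p q \<longleftrightarrow>
     is_functor E E T \<and>
     (\<forall>d\<in>Ob E. is_product E (UNIV :: bool set) (case_bool c d) (fob T d) (case_bool (p d) (q d))) \<and>
     (\<forall>d\<in>Ob E. \<forall>d'\<in>Ob E. \<forall>f\<in>Hom E d d'.
        Comp E (p d') (far T f) = p d \<and> Comp E (q d') (far T f) = Comp E f (q d))"

text \<open>Any two choices of \<open>c \<times> (-)\<close> are naturally isomorphic, so it does not matter which one
  is taken.\<close>

definition products_preserve_small_colimits :: "'u rel \<Rightarrow> ('o, 'm) cat \<Rightarrow> bool" where
  "products_preserve_small_colimits \<kappa> E \<longleftrightarrow>
     (\<forall>c\<in>Ob E. \<exists>T p q. is_product_functor E c T p q \<and> preserves_small_colimits \<kappa> E E T)"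


section \<open>Comma categories and pointwise left Kan extensions\<close>

text \<open>The category \<open>F/c\<close>. An arrow carries its source and target: it is a triple
  \<open>((b, z), f, (b', z'))\<close> with \<open>f : b \<rightarrow> b'\<close> and \<open>z' \<cdot> F f = z\<close>.\<close>

definition comma ::
  "('bo, 'bm) cat \<Rightarrow> ('co, 'cm) cat \<Rightarrow> ('bo, 'bm, 'co, 'cm) fctr \<Rightarrow> 'co
   \<Rightarrow> ('bo \<times> 'cm, ('bo \<times> 'cm) \<times> 'bm \<times> ('bo \<times> 'cm)) cat" where
  "comma B C F c = \<lparr>
     Ob = {(b, z). b \<in> Ob B \<and> z \<in> Hom C (fob F b) c},
     Ar = {((b, z), f, (b', z')).
             b \<in> Ob B \<and> z \<in> Hom C (fob F b) c \<and> b' \<in> Ob B \<and> z' \<in> Hom C (fob F b') c \<and>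
             f \<in> Hom B b b' \<and> Comp C z' (far F f) = z},
     Dom = (\<lambda>(x, f, y). x),
     Cod = (\<lambda>(x, f, y). y),
     Idn = (\<lambda>x. (x, Idn B (fst x), x)),
     Comp = (\<lambda>(x', g, y') (x, f, y). (x, Comp B g f, y'))\<rparr>"

definition comma_forget ::
  "('bo \<times> 'cm, ('bo \<times> 'cm) \<times> 'bm \<times> ('bo \<times> 'cm), 'bo, 'bm) fctr" where
  "comma_forget = \<lparr>fob = fst, far = (\<lambda>(x, f, y). f)\<rparr>"

lemma Hom_comma:
  "u \<in> Hom (comma B C F c) x y \<longleftrightarrow>
     (\<exists>f. u = (x, f, y) \<and> fst x \<in> Ob B \<and> snd x \<in> Hom C (fob F (fst x)) c \<and>
          fst y \<in> Ob B \<and> snd y \<in> Hom C (fob F (fst y)) c \<and>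
          f \<in> Hom B (fst x) (fst y) \<and> Comp C (snd y) (far F f) = snd x)"
  unfolding Hom_def[of "comma B C F c"] by (cases x; cases y) (auto simp: comma_def)

lemma category_comma:
  assumes "category B" "category C" "is_functor B C F"
  shows "category (comma B C F c)"
proof -
  interpret B: category B by fact
  interpret C: category C by fact
  have 1: "Comp C z (far F (Idn B b)) = z" if "b \<in> Ob B" "z \<in> Hom C (fob F b) c" for b z
    using assms(3) that C.comp_id_right unfolding is_functor_def by metis
  have 2: "Comp C z'' (far F (Comp B g f)) = z"
    if "b \<in> Ob B" "b' \<in> Ob B" "b'' \<in> Ob B" "f \<in> Hom B b b'" "g \<in> Hom B b' b''"
      "z'' \<in> Hom C (fob F b'') c" "Comp C z'' (far F g) = z'" "Comp C z' (far F f) = z"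
    for b b' b'' f g z z' z''
  proof -
    have "far F f \<in> Hom C (fob F b) (fob F b')" "far F g \<in> Hom C (fob F b') (fob F b'')"
      "far F (Comp B g f) = Comp C (far F g) (far F f)"
      using assms(3) that unfolding is_functor_def by blast+
    then show ?thesis using C.comp_assoc that by metis
  qed
  show ?thesis
  proof (unfold_locales, goal_cases)
    case (3 a)
    then show ?case
      by (cases a) (simp add: Hom_comma, simp add: comma_def B.id_in_Hom 1)
  next
    case (4 f a b g d)
    then obtain f' g' where "f = (a, f', b)" "g = (b, g', d)"
      "f' \<in> Hom B (fst a) (fst b)" "g' \<in> Hom B (fst b) (fst d)"
      by (auto simp: Hom_comma)
    with 4 show ?case
      by (simp add: Hom_comma B.comp_in_Hom 2)
         (simp add: comma_def B.comp_in_Hom[of f' "fst a" "fst b" g' "fst d"]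
            2[of "fst a" "fst b" "fst d" f' g' "snd d" "snd b" "snd a"])
  next
    case (5 f a b)
    then show ?case by (auto simp: Hom_comma) (simp add: comma_def B.comp_id_right)
  next
    case (6 f a b)
    then show ?case by (auto simp: Hom_comma) (simp add: comma_def B.comp_id_left)
  next
    case (7 f a b g d h e)
    then show ?case by (auto simp: Hom_comma) (simp add: comma_def B.comp_assoc)
  qed (auto simp: comma_def)
qed

lemma is_functor_comma_forget: "is_functor (comma B C F c) B comma_forget"
  unfolding is_functor_def by (auto simp: Hom_comma) (auto simp: comma_def comma_forget_def)

text \<open>\<open>L\<close> is the pointwise left Kan extension of \<open>X\<close> along \<open>F\<close> for the choice of colimits
  \<open>(L c, \<iota> c)\<close> of \<open>X V\<close> over \<open>F/c\<close>. On an arrow \<open>g : c \<rightarrow> c'\<close> it is the induced map between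
  colimits: its composite with the coprojection at \<open>(b, z)\<close> is the coprojection at
  \<open>(b, g \<cdot> z)\<close>.\<close>

definition is_left_kan_extension ::
  "('bo, 'bm) cat \<Rightarrow> ('co, 'cm) cat \<Rightarrow> ('eo, 'em) cat
   \<Rightarrow> ('bo, 'bm, 'co, 'cm) fctr \<Rightarrow> ('bo, 'bm, 'eo, 'em) fctr
   \<Rightarrow> ('co, 'cm, 'eo, 'em) fctr \<Rightarrow> ('co \<Rightarrow> 'bo \<times> 'cm \<Rightarrow> 'em) \<Rightarrow> bool" where
  "is_left_kan_extension B C E F X L \<iota> \<longleftrightarrow>
     is_functor C E L \<and>
     (\<forall>c\<in>Ob C. is_colimit (comma B C F c) E (fcomp X comma_forget) (fob L c) (\<iota> c)) \<and>
     (\<forall>c\<in>Ob C. \<forall>c'\<in>Ob C. \<forall>g\<in>Hom C c c'. \<forall>(b, z)\<in>Ob (comma B C F c).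
        Comp E (far L g) (\<iota> c (b, z)) = \<iota> c' (b, Comp C g z))"

end

(* Let P be a product of the A i in C and Q a product of the L (A i) in E. Since products in E
   commute with colimits in each variable, Q is the colimit, over families w of objects
   (b i, z i) of F/A i, of the products of the X (b i), which are the X (b w) for b w the product
   of the b i in B. The z i pair to a map F (b w) \<rightarrow> P, so the coprojections
   X (b w) \<rightarrow> L P induce a map Q \<rightarrow> L P. It is inverse to the comparison map L P \<rightarrow> Q: one composite
   is the identity by the colimit property of Q, the other because an object (b, z) of F/P
   factors through the diagonal b \<rightarrow> b w of the family w i = (b, \<pi> i z). *)

theory Submission
  imports Defs
begin

section \<open>Arrows and products\<close>

text \<open>The colimit over families is never packaged as \<open>is_colimit\<close> over a product
  of the categories \<open>F/A i\<close>: families are total functions that matter only on the index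
  set, and the hypothesis on E handles one variable at a time. What is used is that each compatible
  \<open>g\<close> has a unique arrow out of \<open>Q\<close> whose composite with every
  \<open>t w\<close> is \<open>g w\<close>. Compatibility concerns all arrows that commute with the
  projections, since products are given only up to isomorphism; the induction on the number of
  variables can then regroup factors freely. For the terminal object its base case alone is used.

  \<open>F (b w)\<close> is in general no product of the \<open>F (b i)\<close>; in C only the
  universal property of \<open>P\<close> is applied. In E, \<open>X (b w)\<close> has to be a
  product: this forces the arrows induced by families of arrows of B to be images under
  \<open>X\<close>.

  Regularity of \<kappa> bounds the size of \<open>F/c\<close>. As the colimit hypotheses speak of
  shapes on the type of \<kappa>, a copy of \<open>F/c\<close> on that type is used.\<close>

lemma in_Hom_iff: "f \<in> Hom C a b \<longleftrightarrow> f \<in> Ar C \<and> Dom C f = a \<and> Cod C f = b"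
  by (auto simp: Hom_def)

context category
begin

lemma id_arrow:
  assumes "a \<in> Ob C"
  shows "Idn C a \<in> Ar C" "Dom C (Idn C a) = a" "Cod C (Idn C a) = a"
  using id_in_Hom[OF assms] by (auto simp: in_Hom_iff)

lemma comp_arrow:
  assumes "f \<in> Ar C" "g \<in> Ar C" "Dom C g = Cod C f"
  shows "Comp C g f \<in> Ar C" "Dom C (Comp C g f) = Dom C f" "Cod C (Comp C g f) = Cod C g"
  using comp_in_Hom[of f "Dom C f" "Cod C f" g "Cod C g"] assms by (auto simp: in_Hom_iff)

lemma comp_id:
  assumes "f \<in> Ar C"
  shows "Dom C f = a \<Longrightarrow> Comp C f (Idn C a) = f" "Cod C f = a \<Longrightarrow> Comp C (Idn C a) f = f"
  using comp_id_right[of f a "Cod C f"] comp_id_left[of f "Dom C f" a] assms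
  by (auto simp: in_Hom_iff)

lemma comp_assoc_arrow:
  assumes "f \<in> Ar C" "g \<in> Ar C" "h \<in> Ar C" "Dom C g = Cod C f" "Dom C h = Cod C g"
  shows "Comp C (Comp C h g) f = Comp C h (Comp C g f)"
  using comp_assoc[of f "Dom C f" "Cod C f" g "Cod C g" h "Cod C h"] assms
  by (auto simp: in_Hom_iff)

lemmas arrow_simps = in_Hom_iff id_arrow comp_arrow comp_id comp_assoc_arrow dom_in_Ob cod_in_Ob

lemma Hom_Ob: "f \<in> Hom C a b \<Longrightarrow> a \<in> Ob C \<and> b \<in> Ob C"
  by (auto simp: in_Hom_iff dom_in_Ob cod_in_Ob)

end

lemma functor_ob: "is_functor A B F \<Longrightarrow> a \<in> Ob A \<Longrightarrow> fob F a \<in> Ob B"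
  by (simp add: is_functor_def)

lemma functor_Hom:
  "is_functor A B F \<Longrightarrow> a \<in> Ob A \<Longrightarrow> b \<in> Ob A \<Longrightarrow> f \<in> Hom A a b \<Longrightarrow>
    far F f \<in> Hom B (fob F a) (fob F b)"
  by (simp add: is_functor_def)

lemma functor_id: "is_functor A B F \<Longrightarrow> a \<in> Ob A \<Longrightarrow> far F (Idn A a) = Idn B (fob F a)"
  by (simp add: is_functor_def)

lemma functor_comp:
  "is_functor A B F \<Longrightarrow> a \<in> Ob A \<Longrightarrow> b \<in> Ob A \<Longrightarrow> c \<in> Ob A \<Longrightarrow>
    f \<in> Hom A a b \<Longrightarrow> g \<in> Hom A b c \<Longrightarrow>
    far F (Comp A g f) = Comp B (far F g) (far F f)"
  unfolding is_functor_def by blast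

section \<open>Universal property of products: reindexing, uniqueness, transport\<close>

lemma is_product_Ob: "is_product E I A P \<pi> \<Longrightarrow> P \<in> Ob E"
  by (simp add: is_product_def)

lemma is_product_proj: "is_product E I A P \<pi> \<Longrightarrow> i \<in> I \<Longrightarrow> \<pi> i \<in> Hom E P (A i)"
  by (simp add: is_product_def)

lemma is_product_universal:
  assumes "is_product E I A P \<pi>" "Y \<in> Ob E" "\<And>i. i \<in> I \<Longrightarrow> f i \<in> Hom E Y (A i)"
  shows "\<exists>!h. h \<in> Hom E Y P \<and> (\<forall>i\<in>I. Comp E (\<pi> i) h = f i)"
  using assms unfolding is_product_def by simp

lemma is_product_tuple:
  assumes "is_product E I A P \<pi>" "Y \<in> Ob E" "\<And>i. i \<in> I \<Longrightarrow> f i \<in> Hom E Y (A i)"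
  obtains h where "h \<in> Hom E Y P" "\<And>i. i \<in> I \<Longrightarrow> Comp E (\<pi> i) h = f i"
  using is_product_universal[OF assms] by blast

lemma is_product_cong:
  assumes "\<And>i. i \<in> I \<Longrightarrow> A i = A' i" "\<And>i. i \<in> I \<Longrightarrow> \<pi> i = \<pi>' i"
  shows "is_product E I A P \<pi> \<longleftrightarrow> is_product E I A' P \<pi>'"
  using assms unfolding is_product_def by (simp cong: ball_cong)

lemma is_product_reindex:
  assumes P: "is_product E I A P \<pi>" and e: "bij_betw e I' I"
  shows "is_product E I' (A \<circ> e) P (\<pi> \<circ> e)"
proof -
  have *: "(\<forall>i\<in>I'. R (e i)) \<longleftrightarrow> (\<forall>i\<in>I. R i)" for R
    unfolding bij_betw_imp_surj_on[OF e, symmetric] by simp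
  have inv: "inv_into I' e (e i) = i" if "i \<in> I'" for i
    using e that by (auto simp: bij_betw_def)
  show ?thesis
    unfolding is_product_def
  proof (intro conjI ballI allI impI)
    show "P \<in> Ob E" using P by (rule is_product_Ob)
    show "(\<pi> \<circ> e) i \<in> Hom E P ((A \<circ> e) i)" if "i \<in> I'" for i
      using P e that by (auto simp: bij_betw_def intro: is_product_proj)
    fix Y f assume Y: "Y \<in> Ob E" and f: "\<forall>i\<in>I'. f i \<in> Hom E Y ((A \<circ> e) i)"
    let ?f = "f \<circ> inv_into I' e"
    have "\<forall>i\<in>I. ?f i \<in> Hom E Y (A i)"
      using f *[of "\<lambda>i. ?f i \<in> Hom E Y (A i)"] by (simp add: inv)
    then have "\<exists>!h. h \<in> Hom E Y P \<and> (\<forall>i\<in>I. Comp E (\<pi> i) h = ?f i)"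
      using P Y unfolding is_product_def by blast
    then show "\<exists>!h. h \<in> Hom E Y P \<and> (\<forall>i\<in>I'. Comp E ((\<pi> \<circ> e) i) h = f i)"
      using *[of "\<lambda>i. Comp E (\<pi> i) _ = ?f i"] by (simp add: inv)
  qed
qed

text \<open>The hypothesis offers only index sets \<open>{..<n}\<close>. A numbering
  \<open>e\<close> of \<open>I\<close> moves the factors there by its inverse and the product back
  by \<open>e\<close>; the round trip restores the factors only on \<open>I\<close>, whence
  \<open>is_product_cong\<close>.\<close>

lemma finite_product_exists:
  assumes "has_finite_products E" "finite I" "\<And>i. i \<in> I \<Longrightarrow> A i \<in> Ob E"
  obtains P \<pi> where "is_product E I A P \<pi>"
proof -
  obtain e where e: "bij_betw e I {..<card I}"
    using ex_bij_betw_finite_nat[OF assms(2)] by (auto simp: atLeast0LessThan)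
  let ?e' = "inv_into I e"
  have e': "bij_betw ?e' {..<card I} I" using e by (rule bij_betw_inv_into)
  then have "\<forall>n<card I. (A \<circ> ?e') n \<in> Ob E"
    using assms(3) by (auto simp: bij_betw_def)
  then obtain P \<pi> where "is_product E {..<card I} (A \<circ> ?e') P \<pi>"
    using assms(1) unfolding has_finite_products_def by blast
  then have "is_product E I (A \<circ> ?e' \<circ> e) P (\<pi> \<circ> e)" using e by (rule is_product_reindex)
  moreover have "(A \<circ> ?e' \<circ> e) i = A i" if "i \<in> I" for i
    using e that by (auto simp: bij_betw_def)
  ultimately have "is_product E I A P (\<pi> \<circ> e)"
    using is_product_cong[of I "A \<circ> ?e' \<circ> e" A "\<pi> \<circ> e" "\<pi> \<circ> e"] by simp
  then show thesis by (rule that)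
qed

context category
begin

text \<open>Joint monicity of the projections: from here on, equations between arrows into a product
  are checked one component at a time.\<close>

lemma is_product_ext:
  assumes P: "is_product C I A P \<pi>" and f: "f \<in> Hom C Y P" and g: "g \<in> Hom C Y P"
    and eq: "\<And>i. i \<in> I \<Longrightarrow> Comp C (\<pi> i) f = Comp C (\<pi> i) g"
  shows "f = g"
proof -
  have "\<exists>!h. h \<in> Hom C Y P \<and> (\<forall>i\<in>I. Comp C (\<pi> i) h = Comp C (\<pi> i) g)"
    using Hom_Ob[OF g]
    by (intro is_product_universal[OF P] comp_in_Hom[OF g] is_product_proj[OF P]) simp_all
  with f g eq show ?thesis by blast
qed

lemma is_product_iso:
  assumes P: "is_product C I A P \<pi>" and P': "is_product C I A P' \<pi>'"
  obtains \<alpha> \<beta> where "\<alpha> \<in> Hom C P P'" "\<beta> \<in> Hom C P' P"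
    "Comp C \<alpha> \<beta> = Idn C P'" "Comp C \<beta> \<alpha> = Idn C P"
    "\<And>i. i \<in> I \<Longrightarrow> Comp C (\<pi>' i) \<alpha> = \<pi> i" "\<And>i. i \<in> I \<Longrightarrow> Comp C (\<pi> i) \<beta> = \<pi>' i"
proof -
  have Ob: "P \<in> Ob C" "P' \<in> Ob C" using P P' by (auto dest: is_product_Ob)
  note pr = is_product_proj[OF P] is_product_proj[OF P']
  obtain \<alpha> where \<alpha>: "\<alpha> \<in> Hom C P P'" "\<And>i. i \<in> I \<Longrightarrow> Comp C (\<pi>' i) \<alpha> = \<pi> i"
    using is_product_tuple[OF P' Ob(1) pr(1)] by metis
  obtain \<beta> where \<beta>: "\<beta> \<in> Hom C P' P" "\<And>i. i \<in> I \<Longrightarrow> Comp C (\<pi> i) \<beta> = \<pi>' i"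
    using is_product_tuple[OF P Ob(2) pr(2)] by metis
  have "Comp C \<alpha> \<beta> = Idn C P'"
  proof (rule is_product_ext[OF P'])
    fix i assume i: "i \<in> I"
    have "Comp C (\<pi>' i) (Comp C \<alpha> \<beta>) = Comp C (Comp C (\<pi>' i) \<alpha>) \<beta>"
      using \<alpha>(1) \<beta>(1) pr(2)[OF i] by (simp add: arrow_simps)
    then show "Comp C (\<pi>' i) (Comp C \<alpha> \<beta>) = Comp C (\<pi>' i) (Idn C P')"
      using \<alpha>(2)[OF i] \<beta>(2)[OF i] pr(2)[OF i] by (simp add: arrow_simps)
  qed (use \<alpha>(1) \<beta>(1) Ob in \<open>auto simp: arrow_simps\<close>)
  moreover have "Comp C \<beta> \<alpha> = Idn C P"
  proof (rule is_product_ext[OF P])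
    fix i assume i: "i \<in> I"
    have "Comp C (\<pi> i) (Comp C \<beta> \<alpha>) = Comp C (Comp C (\<pi> i) \<beta>) \<alpha>"
      using \<alpha>(1) \<beta>(1) pr(1)[OF i] by (simp add: arrow_simps)
    then show "Comp C (\<pi> i) (Comp C \<beta> \<alpha>) = Comp C (\<pi> i) (Idn C P)"
      using \<alpha>(2)[OF i] \<beta>(2)[OF i] pr(1)[OF i] by (simp add: arrow_simps)
  qed (use \<alpha>(1) \<beta>(1) Ob in \<open>auto simp: arrow_simps\<close>)
  ultimately show thesis using that \<alpha> \<beta> by blast
qed

text \<open>For the end of the proof: once \<open>L P\<close> is isomorphic to the product
  \<open>Q\<close> by an arrow with components \<open>far L (\<pi> i)\<close>, it is itself a
  product.\<close>

lemma is_product_transport: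
  assumes P: "is_product C I A P \<pi>" and \<alpha>: "\<alpha> \<in> Hom C P' P" and \<beta>: "\<beta> \<in> Hom C P P'"
    and inv: "Comp C \<alpha> \<beta> = Idn C P" "Comp C \<beta> \<alpha> = Idn C P'"
    and eq: "\<And>i. i \<in> I \<Longrightarrow> Comp C (\<pi> i) \<alpha> = \<pi>' i"
  shows "is_product C I A P' \<pi>'"
  unfolding is_product_def
proof (intro conjI ballI allI impI ex_ex1I)
  note pr = is_product_proj[OF P]
  show "P' \<in> Ob C" using Hom_Ob[OF \<alpha>] by simp
  show "\<pi>' i \<in> Hom C P' (A i)" if "i \<in> I" for i
    using comp_in_Hom[OF \<alpha> pr[OF that]] eq[OF that] by simp
  have eq': "Comp C (\<pi>' i) h = Comp C (\<pi> i) (Comp C \<alpha> h)" if "i \<in> I" "h \<in> Hom C Y P'" for i Y h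
    using eq[OF that(1), symmetric] pr[OF that(1)] that(2) \<alpha> by (simp add: arrow_simps)
  fix Y f assume Y: "Y \<in> Ob C" and f: "\<forall>i\<in>I. f i \<in> Hom C Y (A i)"
  obtain h where h: "h \<in> Hom C Y P" "\<And>i. i \<in> I \<Longrightarrow> Comp C (\<pi> i) h = f i"
    using is_product_tuple[OF P Y] f by metis
  have "Comp C \<alpha> (Comp C \<beta> h) = Comp C (Comp C \<alpha> \<beta>) h"
    using h(1) \<alpha> \<beta> by (simp add: arrow_simps)
  then have "Comp C \<alpha> (Comp C \<beta> h) = h" using h(1) inv by (simp add: arrow_simps)
  then show "\<exists>h. h \<in> Hom C Y P' \<and> (\<forall>i\<in>I. Comp C (\<pi>' i) h = f i)"
    using h comp_in_Hom[OF h(1) \<beta>] eq' by metis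
next
  fix Y f h h'
  assume h: "h \<in> Hom C Y P' \<and> (\<forall>i\<in>I. Comp C (\<pi>' i) h = f i)"
    and h': "h' \<in> Hom C Y P' \<and> (\<forall>i\<in>I. Comp C (\<pi>' i) h' = f i)"
  have eq': "Comp C (\<pi>' i) h = Comp C (\<pi> i) (Comp C \<alpha> h)" if "i \<in> I" "h \<in> Hom C Y P'" for i Y h
    using eq[OF that(1), symmetric] is_product_proj[OF P that(1)] that(2) \<alpha>
    by (simp add: arrow_simps)
  have "Comp C \<alpha> h = Comp C \<alpha> h'"
  proof (rule is_product_ext[OF P])
    show "Comp C \<alpha> h \<in> Hom C Y P" "Comp C \<alpha> h' \<in> Hom C Y P"
      using h h' \<alpha> by (auto intro: comp_in_Hom)
    show "Comp C (\<pi> i) (Comp C \<alpha> h) = Comp C (\<pi> i) (Comp C \<alpha> h')" if "i \<in> I" for i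
      using h h' eq'[OF that] that by metis
  qed
  then have "Comp C (Comp C \<beta> \<alpha>) h = Comp C (Comp C \<beta> \<alpha>) h'"
    using h h' \<alpha> \<beta> by (simp add: arrow_simps)
  then show "h = h'" using h h' inv by (simp add: arrow_simps)
qed

text \<open>Associativity of products. It turns \<open>N \<times> d\<close>, the value of a functor
  \<open>N \<times> (-)\<close>, into a product over a larger index set in which only the factor at
  \<open>k\<close> varies; \<open>True\<close> marks the component \<open>N\<close>.\<close>

lemma is_product_insert:
  assumes N: "is_product C I A N \<sigma>" and k: "k \<notin> I"
    and P: "is_product C UNIV (case_bool N d) P (case_bool p q)"
  shows "is_product C (insert k I) (A(k := d)) P (\<lambda>i. if i = k then q else Comp C (\<sigma> i) p)"
  unfolding is_product_def
proof (intro conjI ballI allI impI ex_ex1I)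
  note \<sigma> = is_product_proj[OF N]
  have p: "p \<in> Hom C P N" using is_product_proj[OF P, of True] by simp
  have q: "q \<in> Hom C P d" using is_product_proj[OF P, of False] by simp
  show "P \<in> Ob C" using P by (rule is_product_Ob)
  show "(if i = k then q else Comp C (\<sigma> i) p) \<in> Hom C P ((A(k := d)) i)" if "i \<in> insert k I" for i
    using that p q \<sigma> comp_in_Hom by auto
  fix Y f assume Y: "Y \<in> Ob C" and f: "\<forall>i\<in>insert k I. f i \<in> Hom C Y ((A(k := d)) i)"
  have "\<And>i. i \<in> I \<Longrightarrow> f i \<in> Hom C Y (A i)" using f k by (metis fun_upd_apply insertCI)
  then obtain h1 where h1: "h1 \<in> Hom C Y N" "\<And>i. i \<in> I \<Longrightarrow> Comp C (\<sigma> i) h1 = f i"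
    using is_product_tuple[OF N Y] by metis
  have "case_bool h1 (f k) b \<in> Hom C Y (case_bool N d b)" for b
    using h1 f by (cases b) auto
  then obtain h where h: "h \<in> Hom C Y P"
      "\<And>b. Comp C (case_bool p q b) h = case_bool h1 (f k) b"
    using is_product_tuple[OF P Y, of "case_bool h1 (f k)"] by auto
  have "Comp C p h = h1" "Comp C q h = f k" using h(2)[of True] h(2)[of False] by auto
  moreover have "Comp C (Comp C (\<sigma> i) p) h = Comp C (\<sigma> i) (Comp C p h)" if "i \<in> I" for i
    using \<sigma>[OF that] p h(1) by (simp add: arrow_simps)
  ultimately show "\<exists>h. h \<in> Hom C Y P \<and>
      (\<forall>i\<in>insert k I. Comp C (if i = k then q else Comp C (\<sigma> i) p) h = f i)"
    using h(1) h1(2) by auto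
next
  note \<sigma> = is_product_proj[OF N]
  have p: "p \<in> Hom C P N" using is_product_proj[OF P, of True] by simp
  fix Y f h h'
  assume h: "h \<in> Hom C Y P \<and>
      (\<forall>i\<in>insert k I. Comp C (if i = k then q else Comp C (\<sigma> i) p) h = f i)"
    and h': "h' \<in> Hom C Y P \<and>
      (\<forall>i\<in>insert k I. Comp C (if i = k then q else Comp C (\<sigma> i) p) h' = f i)"
  have "Comp C p h = Comp C p h'"
  proof (rule is_product_ext[OF N])
    fix i assume i: "i \<in> I"
    then have "Comp C (Comp C (\<sigma> i) p) h = f i" "Comp C (Comp C (\<sigma> i) p) h' = f i"
      using h h' k by (metis insertCI)+
    then have "Comp C (Comp C (\<sigma> i) p) h = Comp C (Comp C (\<sigma> i) p) h'" by simp
    then show "Comp C (\<sigma> i) (Comp C p h) = Comp C (\<sigma> i) (Comp C p h')"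
      using h h' \<sigma>[OF i] p by (simp add: arrow_simps)
  qed (use h h' p in \<open>auto intro: comp_in_Hom\<close>)
  moreover have "Comp C q h = Comp C q h'" using h h' by auto
  ultimately have "Comp C (case_bool p q b) h = Comp C (case_bool p q b) h'" for b
    by (cases b) auto
  then show "h = h'" using h h' is_product_ext[OF P] by blast
qed

end


section \<open>Colimits over small categories on arbitrary types\<close>

lemma is_cocone_cong:
  assumes "category J" "\<And>j. j \<in> Ob J \<Longrightarrow> \<iota> j = \<iota>' j"
  shows "is_cocone J E D Q \<iota> \<longleftrightarrow> is_cocone J E D Q \<iota>'"
  using assms category.dom_in_Ob[OF assms(1)] category.cod_in_Ob[OF assms(1)]
  unfolding is_cocone_def by simp

lemma is_colimit_cong:
  assumes "category J" "\<And>j. j \<in> Ob J \<Longrightarrow> \<iota> j = \<iota>' j"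
  shows "is_colimit J E D Q \<iota> \<longleftrightarrow> is_colimit J E D Q \<iota>'"
  using is_cocone_cong[where E = E and D = D and Q = Q, OF assms] assms(2) unfolding is_colimit_def by simp

text \<open>A cocone tests arrows one at a time and never composes them, so a map onto the arrows
  that respects their ends is enough. The bijection on objects makes every cocone over
  \<open>J'\<close> the pullback of one over \<open>J\<close>.\<close>

lemma is_colimit_reindex:
  assumes J': "category J'" and eb: "bij_betw (fob G) (Ob J') (Ob J)"
    and ab: "far G ` Ar J' = Ar J"
    and dom: "\<And>u. u \<in> Ar J' \<Longrightarrow> Dom J (far G u) = fob G (Dom J' u)"
    and cod: "\<And>u. u \<in> Ar J' \<Longrightarrow> Cod J (far G u) = fob G (Cod J' u)"
  shows "is_colimit J' E (fcomp D G) Q (\<iota> \<circ> fob G) \<longleftrightarrow> is_colimit J E D Q \<iota>"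
proof -
  have o: "(\<forall>j\<in>Ob J. R j) \<longleftrightarrow> (\<forall>j\<in>Ob J'. R (fob G j))" for R
    unfolding bij_betw_imp_surj_on[OF eb, symmetric] by simp
  have a: "(\<forall>u\<in>Ar J. R u) \<longleftrightarrow> (\<forall>u\<in>Ar J'. R (far G u))" for R
    unfolding ab[symmetric] by simp
  have cocone: "is_cocone J' E (fcomp D G) Q (\<iota> \<circ> fob G) \<longleftrightarrow> is_cocone J E D Q \<iota>" for Q \<iota>
    unfolding is_cocone_def o a by (simp add: fcomp_def dom cod)
  \<comment> \<open>The pullback reproduces a given family of legs only on \<open>Ob J'\<close>;
    \<open>is_cocone_cong\<close> makes up for the difference elsewhere.\<close>
  have ext: "\<exists>\<iota>. \<forall>j\<in>Ob J'. \<iota>' j = (\<iota> \<circ> fob G) j" for \<iota>' :: "_ \<Rightarrow> 'z"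
    using eb by (intro exI[of _ "\<iota>' \<circ> inv_into (Ob J') (fob G)"]) (auto simp: bij_betw_def)
  have "(\<forall>\<iota>'. is_cocone J' E (fcomp D G) Q' \<iota>' \<longrightarrow>
           (\<exists>!h. h \<in> Hom E Q Q' \<and> (\<forall>j\<in>Ob J'. Comp E h ((\<iota> \<circ> fob G) j) = \<iota>' j)))
    \<longleftrightarrow> (\<forall>\<iota>'. is_cocone J E D Q' \<iota>' \<longrightarrow>
           (\<exists>!h. h \<in> Hom E Q Q' \<and> (\<forall>j\<in>Ob J. Comp E h (\<iota> j) = \<iota>' j)))" (is "?L = ?R") for Q'
  proof
    assume L: ?L
    show ?R
    proof (intro allI impI)
      fix \<iota>' assume "is_cocone J E D Q' \<iota>'"
      then have "is_cocone J' E (fcomp D G) Q' (\<iota>' \<circ> fob G)" by (simp only: cocone)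
      with L have "\<exists>!h. h \<in> Hom E Q Q' \<and> (\<forall>j\<in>Ob J'. Comp E h ((\<iota> \<circ> fob G) j) = (\<iota>' \<circ> fob G) j)"
        by blast
      then show "\<exists>!h. h \<in> Hom E Q Q' \<and> (\<forall>j\<in>Ob J. Comp E h (\<iota> j) = \<iota>' j)"
        unfolding o by simp
    qed
  next
    assume R: ?R
    show ?L
    proof (intro allI impI)
      fix \<iota>' assume c: "is_cocone J' E (fcomp D G) Q' \<iota>'"
      obtain \<iota>'' where \<iota>'': "\<forall>j\<in>Ob J'. \<iota>' j = (\<iota>'' \<circ> fob G) j" using ext by blast
      have "is_cocone J E D Q' \<iota>''"
        using c is_cocone_cong[OF J', of \<iota>' "\<iota>'' \<circ> fob G" E "fcomp D G" Q'] \<iota>'' cocone[of Q' \<iota>'']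
        by simp
      with R have "\<exists>!h. h \<in> Hom E Q Q' \<and> (\<forall>j\<in>Ob J. Comp E h (\<iota> j) = \<iota>'' j)" by blast
      then show "\<exists>!h. h \<in> Hom E Q Q' \<and> (\<forall>j\<in>Ob J'. Comp E h ((\<iota> \<circ> fob G) j) = \<iota>' j)"
        unfolding o using \<iota>'' by simp
    qed
  qed
  then show ?thesis unfolding is_colimit_def cocone by presburger
qed

section \<open>Copies of small categories on the type of \<kappa>\<close>

lemma small_set_embeds:
  fixes \<kappa> :: "'u rel"
  assumes "Card_order \<kappa>" "|A| <o \<kappa>"
  obtains f :: "'a \<Rightarrow> 'u" where "inj_on f A"
proof -
  have "|A| \<le>o |Field \<kappa>|"
    using assms card_of_Field_ordIso ordIso_symmetric ordLess_imp_ordLeq ordLeq_ordIso_trans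
    by blast
  then show thesis using that card_of_ordLeq[of A "Field \<kappa>"] by blast
qed

text \<open>Transport of structure along injections \<open>e\<close> and \<open>a\<close> of objects
  and arrows into \<open>'u\<close>, with inverses \<open>e'\<close> and \<open>a'\<close>. The
  colimit hypotheses quantify over shapes on \<open>'u\<close>, while comma categories live on types
  of pairs and triples.\<close>

lemma small_cat_model:
  fixes \<kappa> :: "'u rel" and J :: "('j, 'k) cat"
  assumes "Card_order \<kappa>" "category J" "small_cat \<kappa> J"
  obtains J' :: "('u, 'u) cat" and G where
    "category J'" "small_cat \<kappa> J'" "is_functor J' J G"
    "bij_betw (fob G) (Ob J') (Ob J)" "far G ` Ar J' = Ar J"
    "\<And>u. u \<in> Ar J' \<Longrightarrow> Dom J (far G u) = fob G (Dom J' u)"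
    "\<And>u. u \<in> Ar J' \<Longrightarrow> Cod J (far G u) = fob G (Cod J' u)"
proof -
  interpret J: category J by fact
  obtain e :: "'j \<Rightarrow> 'u" where e: "inj_on e (Ob J)"
    using small_set_embeds assms unfolding small_cat_def by metis
  obtain a :: "'k \<Rightarrow> 'u" where a: "inj_on a (Ar J)"
    using small_set_embeds assms unfolding small_cat_def by metis
  define e' where "e' = inv_into (Ob J) e"
  define a' where "a' = inv_into (Ar J) a"
  have e': "e' (e j) = j" if "j \<in> Ob J" for j using e that by (simp add: e'_def)
  have a': "a' (a u) = u" if "u \<in> Ar J" for u using a that by (simp add: a'_def)
  define J' where "J' = \<lparr>Ob = e ` Ob J, Ar = a ` Ar J, Dom = (\<lambda>u. e (Dom J (a' u))),
    Cod = (\<lambda>u. e (Cod J (a' u))), Idn = (\<lambda>j. a (Idn J (e' j))),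
    Comp = (\<lambda>g f. a (Comp J (a' g) (a' f)))\<rparr>"
  define G where "G = \<lparr>fob = e', far = a'\<rparr>"
  have sel: "Ob J' = e ` Ob J" "Ar J' = a ` Ar J" "Dom J' u = e (Dom J (a' u))"
    "Cod J' u = e (Cod J (a' u))" "Idn J' j = a (Idn J (e' j))"
    "Comp J' g f = a (Comp J (a' g) (a' f))" "fob G = e'" "far G = a'" for u j g f
    by (simp_all add: J'_def G_def)
  have e_eq: "e i = e j \<longleftrightarrow> i = j" if "i \<in> Ob J" "j \<in> Ob J" for i j
    using e that by (auto dest: inj_onD)
  have "category J'"
  proof
    fix f i j g k assume "f \<in> Hom J' i j" "g \<in> Hom J' j k"
    then show "Comp J' g f \<in> Hom J' i k"
      by (auto simp: in_Hom_iff sel a' J.arrow_simps e_eq)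
  next
    fix f i j assume "f \<in> Hom J' i j"
    then show "Comp J' f (Idn J' i) = f" "Comp J' (Idn J' j) f = f"
      by (auto simp: in_Hom_iff sel a' e' J.arrow_simps)
  next
    fix f i j g k h l assume "f \<in> Hom J' i j" "g \<in> Hom J' j k" "h \<in> Hom J' k l"
    then show "Comp J' h (Comp J' g f) = Comp J' (Comp J' h g) f"
      by (auto simp: in_Hom_iff sel a' e' J.arrow_simps e_eq)
  qed (auto simp: in_Hom_iff sel a' e' J.arrow_simps)
  moreover have "small_cat \<kappa> J'"
    using assms(3) unfolding small_cat_def sel
    by (auto intro: ordLeq_ordLess_trans[OF card_of_image])
  moreover have "is_functor J' J G"
    unfolding is_functor_def by (auto simp: in_Hom_iff sel a' e' J.arrow_simps e_eq)
  moreover have "bij_betw (fob G) (Ob J') (Ob J)"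
    unfolding sel e'_def by (intro bij_betw_inv_into inj_on_imp_bij_betw e)
  moreover have "far G ` Ar J' = Ar J" by (force simp: sel a')
  moreover have "Dom J (far G u) = fob G (Dom J' u)" "Cod J (far G u) = fob G (Cod J' u)"
    if "u \<in> Ar J'" for u
    using that by (auto simp: sel a' e' J.arrow_simps)
  ultimately show thesis by (rule that)
qed

lemma is_functor_fcomp:
  assumes "is_functor A B F" "is_functor B C G"
  shows "is_functor A C (fcomp G F)"
proof -
  note ob = functor_ob[OF assms(1)] and hom = functor_Hom[OF assms(1)]
  have "far G (far F (Comp A g f)) = Comp C (far G (far F g)) (far G (far F f))"
    if "a \<in> Ob A" "b \<in> Ob A" "c \<in> Ob A" "f \<in> Hom A a b" "g \<in> Hom A b c" for a b c f g
    using functor_comp[OF assms(2) ob[OF that(1)] ob[OF that(2)] ob[OF that(3)]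
        hom[OF that(1,2,4)] hom[OF that(2,3,5)]] functor_comp[OF assms(1) that] by simp
  moreover have "far G (far F f) \<in> Hom C (fob G (fob F a)) (fob G (fob F b))"
    if "a \<in> Ob A" "b \<in> Ob A" "f \<in> Hom A a b" for a b f
    using functor_Hom[OF assms(2) ob[OF that(1)] ob[OF that(2)] hom[OF that]] .
  ultimately show ?thesis
    using assms unfolding is_functor_def[of A C] fcomp_def by (simp add: functor_ob functor_id)
qed

lemma fcomp_assoc: "fcomp (fcomp H G) F = fcomp H (fcomp G F)"
  by (simp add: fcomp_def comp_assoc)

lemma small_colimit_exists:
  fixes \<kappa> :: "'u rel"
  assumes "Card_order \<kappa>" "has_small_colimits \<kappa> E"
    and J: "category J" "small_cat \<kappa> J" "is_functor J E D"
  obtains Q \<iota> where "is_colimit J E D Q \<iota>"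
proof -
  obtain J' :: "('u, 'u) cat" and G where J': "category J'" "small_cat \<kappa> J'" "is_functor J' J G"
    "bij_betw (fob G) (Ob J') (Ob J)" "far G ` Ar J' = Ar J"
    "\<And>u. u \<in> Ar J' \<Longrightarrow> Dom J (far G u) = fob G (Dom J' u)"
    "\<And>u. u \<in> Ar J' \<Longrightarrow> Cod J (far G u) = fob G (Cod J' u)"
    using small_cat_model[OF assms(1) J(1,2)] by blast
  have "is_functor J' E (fcomp D G)" using J'(3) J(3) by (rule is_functor_fcomp)
  then obtain Q \<iota>' where Q: "is_colimit J' E (fcomp D G) Q \<iota>'"
    using assms(2) J'(1,2) unfolding has_small_colimits_def by blast
  \<comment> \<open>The legs over the copy are indexed by codes in \<open>'u\<close>; the inverse of
    \<open>fob G\<close> reads them back as legs over \<open>J\<close>.\<close>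
  let ?\<iota> = "\<iota>' \<circ> inv_into (Ob J') (fob G)"
  have "\<iota>' j = (?\<iota> \<circ> fob G) j" if "j \<in> Ob J'" for j
    using J'(4) that by (auto simp: bij_betw_def)
  then have "is_colimit J' E (fcomp D G) Q (?\<iota> \<circ> fob G)"
    using is_colimit_cong[OF J'(1), of \<iota>' "?\<iota> \<circ> fob G" E "fcomp D G" Q] Q by simp
  then have "is_colimit J E D Q ?\<iota>" by (simp only: is_colimit_reindex[OF J'(1,4-7)])
  then show thesis by (rule that)
qed

lemma small_colimit_preserved:
  fixes \<kappa> :: "'u rel"
  assumes "Card_order \<kappa>" "preserves_small_colimits \<kappa> A E T"
    and J: "category J" "small_cat \<kappa> J" "is_functor J A D" and Q: "is_colimit J A D Q \<iota>"
  shows "is_colimit J E (fcomp T D) (fob T Q) (\<lambda>j. far T (\<iota> j))"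
proof -
  obtain J' :: "('u, 'u) cat" and G where J': "category J'" "small_cat \<kappa> J'" "is_functor J' J G"
    "bij_betw (fob G) (Ob J') (Ob J)" "far G ` Ar J' = Ar J"
    "\<And>u. u \<in> Ar J' \<Longrightarrow> Dom J (far G u) = fob G (Dom J' u)"
    "\<And>u. u \<in> Ar J' \<Longrightarrow> Cod J (far G u) = fob G (Cod J' u)"
    using small_cat_model[OF assms(1) J(1,2)] by blast
  note reindex = is_colimit_reindex[OF J'(1,4-7)]
  have "is_functor J' A (fcomp D G)" using J'(3) J(3) by (rule is_functor_fcomp)
  moreover have "is_colimit J' A (fcomp D G) Q (\<iota> \<circ> fob G)" using Q by (simp only: reindex)
  ultimately have "is_colimit J' E (fcomp T (fcomp D G)) (fob T Q) (\<lambda>j. far T ((\<iota> \<circ> fob G) j))"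
    using assms(2) J'(1,2) unfolding preserves_small_colimits_def by blast
  then show ?thesis
    using reindex[of E "fcomp T D" "fob T Q" "\<lambda>j. far T (\<iota> j)"] by (simp add: fcomp_assoc comp_def)
qed


section \<open>Colimits of products in several variables\<close>

lemma (in category) cancel_iso:
  assumes "\<alpha> \<in> Hom C a b" "\<beta> \<in> Hom C b a" "Comp C \<beta> \<alpha> = Idn C a"
  shows "f \<in> Hom C y a \<Longrightarrow> Comp C \<beta> (Comp C \<alpha> f) = f"
    and "h \<in> Hom C a z \<Longrightarrow> Comp C (Comp C h \<beta>) \<alpha> = h"
proof -
  assume f: "f \<in> Hom C y a"
  have "Comp C \<beta> (Comp C \<alpha> f) = Comp C (Comp C \<beta> \<alpha>) f"
    using f assms(1,2) by (simp add: arrow_simps)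
  then show "Comp C \<beta> (Comp C \<alpha> f) = f" using f assms by (simp add: arrow_simps)
next
  assume h: "h \<in> Hom C a z"
  then show "Comp C (Comp C h \<beta>) \<alpha> = h" using assms by (simp add: arrow_simps)
qed

text \<open>Rests on preservation of the colimit \<open>Q\<close> by \<open>N \<times> (-)\<close>,
  where \<open>N\<close> is the product of the factors over \<open>K\<close>. The statement is freed
  from the chosen values of that functor: \<open>M\<close> and the \<open>R l\<close> are arbitrary
  products. An arrow \<open>r\<close> as in \<open>compat\<close> is the one induced by
  \<open>far D u\<close> at \<open>k\<close> and identities elsewhere; its components determine
  it.\<close>

lemma product_colimit_one_variable:
  fixes \<kappa> :: "'u rel"
  assumes \<kappa>: "Card_order \<kappa>" and "category E" and fp: "has_finite_products E"
    and pc: "products_preserve_small_colimits \<kappa> E"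
    and J: "category J" "small_cat \<kappa> J" "is_functor J E D" and Q: "is_colimit J E D Q \<iota>"
    and K: "finite K" "k \<notin> K"
    and M: "is_product E (insert k K) (A(k := Q)) M \<mu>"
    and R: "\<And>l. l \<in> Ob J \<Longrightarrow> is_product E (insert k K) (A(k := fob D l)) (R l) (\<rho> l)"
    and t: "\<And>l. l \<in> Ob J \<Longrightarrow> t l \<in> Hom E (R l) M"
    and tK: "\<And>l i. l \<in> Ob J \<Longrightarrow> i \<in> K \<Longrightarrow> Comp E (\<mu> i) (t l) = \<rho> l i"
    and tk: "\<And>l. l \<in> Ob J \<Longrightarrow> Comp E (\<mu> k) (t l) = Comp E (\<iota> l) (\<rho> l k)"
    and Y: "Y \<in> Ob E"
    and g: "\<And>l. l \<in> Ob J \<Longrightarrow> g l \<in> Hom E (R l) Y"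
    and compat: "\<And>u r. u \<in> Ar J \<Longrightarrow> r \<in> Hom E (R (Dom J u)) (R (Cod J u)) \<Longrightarrow>
      \<forall>i\<in>K. Comp E (\<rho> (Cod J u) i) r = \<rho> (Dom J u) i \<Longrightarrow>
      Comp E (\<rho> (Cod J u) k) r = Comp E (far D u) (\<rho> (Dom J u) k) \<Longrightarrow>
      Comp E (g (Cod J u)) r = g (Dom J u)"
  shows "\<exists>!h. h \<in> Hom E M Y \<and> (\<forall>l\<in>Ob J. Comp E h (t l) = g l)"
proof -
  interpret E: category E by fact
  interpret J: category J by fact
  have A: "A i \<in> Ob E" if "i \<in> K" for i
    using E.Hom_Ob[OF is_product_proj[OF M, of i]] that K(2) by (auto split: if_splits)
  obtain N \<sigma> where N: "is_product E K A N \<sigma>"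
    using finite_product_exists[OF fp K(1), of A] A by blast
  obtain T p q where T: "is_product_functor E N T p q" and Tc: "preserves_small_colimits \<kappa> E E T"
    using pc is_product_Ob[OF N] unfolding products_preserve_small_colimits_def by blast
  have Tf: "is_functor E E T" using T by (simp add: is_product_functor_def)
  \<comment> \<open>The projections of \<open>T d\<close> once it is read as a product over
    \<open>insert k K\<close> with \<open>d\<close> at \<open>k\<close>.\<close>
  define \<tau> where "\<tau> d i = (if i = k then q d else Comp E (\<sigma> i) (p d))" for d i
  have Tpr: "is_product E UNIV (case_bool N d) (fob T d) (case_bool (p d) (q d))"
    if "d \<in> Ob E" for d
    using T that by (simp add: is_product_functor_def)
  have TP: "is_product E (insert k K) (A(k := d)) (fob T d) (\<tau> d)" if "d \<in> Ob E" for d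
    using E.is_product_insert[OF N K(2) Tpr[OF that]] by (simp add: \<tau>_def[abs_def])
  have Thom: "far T f \<in> Hom E (fob T d) (fob T d')" if "f \<in> Hom E d d'" for f d d'
    using functor_Hom[OF Tf _ _ that] E.Hom_Ob[OF that] by simp
  have Tk: "Comp E (\<tau> d' k) (far T f) = Comp E f (\<tau> d k)" if "f \<in> Hom E d d'" for f d d'
    using T that E.Hom_Ob[OF that] by (simp add: is_product_functor_def \<tau>_def)
  have TK: "Comp E (\<tau> d' i) (far T f) = \<tau> d i" if f: "f \<in> Hom E d d'" and i: "i \<in> K" for f d d' i
  proof -
    have "p d' \<in> Hom E (fob T d') N"
      using is_product_proj[OF Tpr, of d' True] E.Hom_Ob[OF f] by simp
    moreover have "Comp E (p d') (far T f) = p d"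
      using T f E.Hom_Ob[OF f] by (simp add: is_product_functor_def)
    ultimately show ?thesis
      using is_product_proj[OF N i] Thom[OF f] i K(2) by (auto simp: \<tau>_def E.arrow_simps)
  qed
  have cocone: "is_cocone J E D Q \<iota>" using Q by (simp add: is_colimit_def)
  have QOb: "Q \<in> Ob E" and \<iota>: "\<And>l. l \<in> Ob J \<Longrightarrow> \<iota> l \<in> Hom E (fob D l) Q"
    using cocone by (auto simp: is_cocone_def)
  have DOb: "fob D l \<in> Ob E" if "l \<in> Ob J" for l using J(3) that by (rule functor_ob)
  have Dhom: "far D u \<in> Hom E (fob D (Dom J u)) (fob D (Cod J u))" if "u \<in> Ar J" for u
    using that by (intro functor_Hom[OF J(3)]) (auto simp: J.arrow_simps)
  obtain \<alpha> \<alpha>' where \<alpha>: "\<alpha> \<in> Hom E M (fob T Q)" "\<alpha>' \<in> Hom E (fob T Q) M"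
    "Comp E \<alpha> \<alpha>' = Idn E (fob T Q)" "Comp E \<alpha>' \<alpha> = Idn E M"
    "\<And>i. i \<in> insert k K \<Longrightarrow> Comp E (\<tau> Q i) \<alpha> = \<mu> i"
    using E.is_product_iso[OF M TP[OF QOb]] by metis
  \<comment> \<open>Both directions of the isomorphism and all its equations go into one predicate
    on a pair, so that a single choice serves all \<open>l\<close>.\<close>
  define iso where "iso l bb \<longleftrightarrow>
      fst bb \<in> Hom E (fob T (fob D l)) (R l) \<and> snd bb \<in> Hom E (R l) (fob T (fob D l)) \<and>
      Comp E (fst bb) (snd bb) = Idn E (R l) \<and> Comp E (snd bb) (fst bb) = Idn E (fob T (fob D l)) \<and>
      (\<forall>i\<in>insert k K. Comp E (\<rho> l i) (fst bb) = \<tau> (fob D l) i) \<and>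
      (\<forall>i\<in>insert k K. Comp E (\<tau> (fob D l) i) (snd bb) = \<rho> l i)" for l bb
  have "\<forall>l\<in>Ob J. \<exists>bb. iso l bb"
  proof
    fix l assume l: "l \<in> Ob J"
    show "\<exists>bb. iso l bb"
      by (rule E.is_product_iso[OF TP[OF DOb[OF l]] R[OF l]]) (auto simp: iso_def)
  qed
  from bchoice[OF this] obtain bb where bb: "\<And>l. l \<in> Ob J \<Longrightarrow> iso l (bb l)" by blast
  define \<beta> \<beta>' where "\<beta> l = fst (bb l)" and "\<beta>' l = snd (bb l)" for l
  have \<beta>: "\<beta> l \<in> Hom E (fob T (fob D l)) (R l)" "\<beta>' l \<in> Hom E (R l) (fob T (fob D l))"
    "Comp E (\<beta> l) (\<beta>' l) = Idn E (R l)" "Comp E (\<beta>' l) (\<beta> l) = Idn E (fob T (fob D l))"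
    "\<And>i. i \<in> insert k K \<Longrightarrow> Comp E (\<rho> l i) (\<beta> l) = \<tau> (fob D l) i"
    "\<And>i. i \<in> insert k K \<Longrightarrow> Comp E (\<tau> (fob D l) i) (\<beta>' l) = \<rho> l i" if "l \<in> Ob J" for l
    using bb[OF that] unfolding iso_def \<beta>_def \<beta>'_def by blast+
  \<comment> \<open>Up to the isomorphisms \<alpha> and \<open>\<beta>' l\<close>, the arrow
    \<open>t l\<close> is \<open>far T (\<iota> l)\<close>: the two have equal components.\<close>
  have key: "Comp E (far T (\<iota> l)) (\<beta>' l) = Comp E \<alpha> (t l)" if l: "l \<in> Ob J" for l
  proof (rule E.is_product_ext[OF TP[OF QOb]])
    note hom = Thom[OF \<iota>[OF l]] \<beta>(1,2)[OF l] \<alpha>(1) t[OF l] \<iota>[OF l]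
    show "Comp E (far T (\<iota> l)) (\<beta>' l) \<in> Hom E (R l) (fob T Q)"
      "Comp E \<alpha> (t l) \<in> Hom E (R l) (fob T Q)"
      using hom by (auto simp: E.arrow_simps)
    fix i assume i: "i \<in> insert k K"
    note pr = is_product_proj[OF TP[OF QOb] i] is_product_proj[OF TP[OF DOb[OF l]] i]
    have "Comp E (\<tau> Q i) (Comp E \<alpha> (t l)) = Comp E (Comp E (\<tau> Q i) \<alpha>) (t l)"
      using hom pr by (simp add: E.arrow_simps)
    also have "\<dots> = Comp E (\<mu> i) (t l)" using \<alpha>(5)[OF i] by simp
    also have "\<dots> = Comp E (Comp E (\<tau> Q i) (far T (\<iota> l))) (\<beta>' l)"
    proof (cases "i = k")
      case True
      then show ?thesis
        using Tk[OF \<iota>[OF l]] tk[OF l] hom pr \<beta>(6)[OF l i] by (simp add: E.arrow_simps)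
    next
      case False
      then have "i \<in> K" using i by simp
      then show ?thesis using TK[OF \<iota>[OF l]] tK[OF l] \<beta>(6)[OF l i] by simp
    qed
    also have "\<dots> = Comp E (\<tau> Q i) (Comp E (far T (\<iota> l)) (\<beta>' l))"
      using hom pr by (simp add: E.arrow_simps)
    finally show "Comp E (\<tau> Q i) (Comp E (far T (\<iota> l)) (\<beta>' l)) = Comp E (\<tau> Q i) (Comp E \<alpha> (t l))"
      by simp
  qed
  \<comment> \<open>Precomposition with \<open>\<beta> l\<close> turns the given arrows into a
    cocone on the diagram \<open>fcomp T D\<close>, whose colimit is known.\<close>
  define \<gamma> where "\<gamma> l = Comp E (g l) (\<beta> l)" for l
  have "is_cocone J E (fcomp T D) Y \<gamma>"
    unfolding is_cocone_def
  proof (intro conjI ballI Y)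
    show "\<gamma> l \<in> Hom E (fob (fcomp T D) l) Y" if "l \<in> Ob J" for l
      using E.comp_in_Hom[OF \<beta>(1)[OF that] g[OF that]] by (simp add: \<gamma>_def fcomp_def)
    fix u assume u: "u \<in> Ar J"
    let ?l = "Dom J u" and ?l' = "Cod J u"
    have l: "?l \<in> Ob J" "?l' \<in> Ob J" using u by (auto simp: J.arrow_simps)
    note hom = Thom[OF Dhom[OF u]] \<beta>(1,2)[OF l(1)] \<beta>(1,2)[OF l(2)] g[OF l(1)] g[OF l(2)]
    \<comment> \<open>What \<open>far T (far D u)\<close> becomes between the products
      \<open>R\<close>; its components are those that \<open>compat\<close> asks for.\<close>
    define r where "r = Comp E (\<beta> ?l') (Comp E (far T (far D u)) (\<beta>' ?l))"
    have r: "r \<in> Hom E (R ?l) (R ?l')" using hom by (simp add: r_def E.arrow_simps)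
    have comps: "Comp E (\<rho> ?l' i) r = Comp E (Comp E (\<tau> (fob D ?l') i) (far T (far D u))) (\<beta>' ?l)"
      if i: "i \<in> insert k K" for i
    proof -
      have "Comp E (\<rho> ?l' i) r = Comp E (Comp E (\<rho> ?l' i) (\<beta> ?l')) (Comp E (far T (far D u)) (\<beta>' ?l))"
        using hom is_product_proj[OF R[OF l(2)] i] by (simp add: r_def E.arrow_simps)
      then show ?thesis
        using hom is_product_proj[OF TP[OF DOb[OF l(2)]] i] \<beta>(5)[OF l(2) i]
        by (simp add: E.arrow_simps)
    qed
    have "Comp E (g ?l') r = g ?l"
    proof (rule compat[OF u r])
      show "\<forall>i\<in>K. Comp E (\<rho> ?l' i) r = \<rho> ?l i"
        using comps TK[OF Dhom[OF u]] \<beta>(6)[OF l(1)] by simp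
      have "Comp E (\<rho> ?l' k) r = Comp E (Comp E (far D u) (\<tau> (fob D ?l) k)) (\<beta>' ?l)"
        using comps[of k] Tk[OF Dhom[OF u]] by simp
      then show "Comp E (\<rho> ?l' k) r = Comp E (far D u) (\<rho> ?l k)"
        using hom is_product_proj[OF TP[OF DOb[OF l(1)]], of k] Dhom[OF u] \<beta>(6)[OF l(1), of k]
        by (simp add: E.arrow_simps)
    qed
    then have "\<gamma> ?l = Comp E (Comp E (g ?l') r) (\<beta> ?l)" by (simp add: \<gamma>_def)
    also have "\<dots> = Comp E (\<gamma> ?l') (Comp E (far T (far D u)) (Comp E (\<beta>' ?l) (\<beta> ?l)))"
      using hom by (simp add: r_def \<gamma>_def E.arrow_simps)
    also have "\<dots> = Comp E (\<gamma> ?l') (far T (far D u))"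
      using hom \<beta>(4)[OF l(1)] by (simp add: E.arrow_simps)
    finally show "Comp E (\<gamma> ?l') (far (fcomp T D) u) = \<gamma> ?l" by (simp add: fcomp_def)
  qed
  moreover have "is_colimit J E (fcomp T D) (fob T Q) (\<lambda>j. far T (\<iota> j))"
    by (rule small_colimit_preserved[OF \<kappa> Tc J Q])
  ultimately have h0: "\<exists>!h. h \<in> Hom E (fob T Q) Y \<and> (\<forall>l\<in>Ob J. Comp E h (far T (\<iota> l)) = \<gamma> l)"
    by (simp add: is_colimit_def)
  \<comment> \<open>Precomposition with \<alpha> is a bijection from arrows out of
    \<open>fob T Q\<close> to arrows out of \<open>M\<close>, and it matches the two factorization
    problems.\<close>
  have iff: "Comp E h (far T (\<iota> l)) = \<gamma> l \<longleftrightarrow> Comp E (Comp E h \<alpha>) (t l) = g l"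
    if h: "h \<in> Hom E (fob T Q) Y" and l: "l \<in> Ob J" for h l
  proof -
    note hom = h Thom[OF \<iota>[OF l]] \<beta>(1,2)[OF l] g[OF l] \<alpha>(1) t[OF l]
    have eq: "Comp E (Comp E h (far T (\<iota> l))) (\<beta>' l) = Comp E (Comp E h \<alpha>) (t l)"
      using hom key[OF l] by (simp add: E.arrow_simps)
    have "Comp E (Comp E h (far T (\<iota> l))) (\<beta>' l) = Comp E (\<gamma> l) (\<beta>' l) \<longleftrightarrow>
        Comp E h (far T (\<iota> l)) = \<gamma> l"
      using E.cancel_iso(2)[OF \<beta>(1,2)[OF l] \<beta>(4)[OF l]] E.comp_in_Hom[OF hom(2) h]
        E.comp_in_Hom[OF hom(3) hom(5)] unfolding \<gamma>_def by metis
    moreover have "Comp E (\<gamma> l) (\<beta>' l) = g l"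
      using E.cancel_iso(2)[OF \<beta>(2,1)[OF l] \<beta>(3)[OF l] g[OF l]] by (simp add: \<gamma>_def)
    ultimately show ?thesis using eq by simp
  qed
  show ?thesis
  proof (rule ex_ex1I)
    obtain h where "h \<in> Hom E (fob T Q) Y" "\<forall>l\<in>Ob J. Comp E h (far T (\<iota> l)) = \<gamma> l"
      using h0 by blast
    then show "\<exists>h. h \<in> Hom E M Y \<and> (\<forall>l\<in>Ob J. Comp E h (t l) = g l)"
      using iff E.comp_in_Hom[OF \<alpha>(1)] by blast
    fix h h'
    assume h: "h \<in> Hom E M Y \<and> (\<forall>l\<in>Ob J. Comp E h (t l) = g l)"
      and h': "h' \<in> Hom E M Y \<and> (\<forall>l\<in>Ob J. Comp E h' (t l) = g l)"
    note c = E.cancel_iso(2)[OF \<alpha>(1,2,4)]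
    have "Comp E h \<alpha>' = Comp E h' \<alpha>'"
    proof (rule ex1E[OF h0])
      fix h1 assume *: "\<forall>h. h \<in> Hom E (fob T Q) Y \<and> (\<forall>l\<in>Ob J. Comp E h (far T (\<iota> l)) = \<gamma> l) \<longrightarrow> h = h1"
      have "Comp E x \<alpha>' = h1" if "x \<in> Hom E M Y \<and> (\<forall>l\<in>Ob J. Comp E x (t l) = g l)" for x
        using * iff[of "Comp E x \<alpha>'"] c[of x Y] that E.comp_in_Hom[OF \<alpha>(2), of x Y] by simp
      then show ?thesis using h h' by metis
    qed
    then show "h = h'" using c[of h Y] c[of h' Y] h h' by metis
  qed
qed

text \<open>Products over \<open>K\<close> whose factors with index in \<open>S\<close> run through the diagrams \<open>D i\<close>, while the
  other factors \<open>W i\<close> stay fixed: \<open>M\<close> is the product with \<open>D i\<close> replaced by its colimit, \<open>t j\<close> is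
  the product of the coprojections, and \<open>g\<close> is a cocone to \<open>Y\<close>. Since \<open>R j\<close> is an arbitrary choice
  of products and \<open>j\<close> is unconstrained outside \<open>S\<close>, naturality of \<open>g\<close> is stated for every arrow \<open>r\<close>
  that is compatible with the projections.\<close>

definition product_cocone where
  "product_cocone E K J D Q \<iota> Y S W M \<mu> R \<rho> t g \<longleftrightarrow>
     is_product E K (\<lambda>i. if i \<in> S then Q i else W i) M \<mu> \<and>
     (\<forall>j. (\<forall>i\<in>S. j i \<in> Ob (J i)) \<longrightarrow>
        is_product E K (\<lambda>i. if i \<in> S then fob (D i) (j i) else W i) (R j) (\<rho> j) \<and>
        t j \<in> Hom E (R j) M \<and>
        (\<forall>i\<in>S. Comp E (\<mu> i) (t j) = Comp E (\<iota> i (j i)) (\<rho> j i)) \<and>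
        (\<forall>i\<in>K - S. Comp E (\<mu> i) (t j) = \<rho> j i) \<and>
        g j \<in> Hom E (R j) Y) \<and>
     (\<forall>j j' u r.
        (\<forall>i\<in>S. j i \<in> Ob (J i) \<and> j' i \<in> Ob (J i) \<and> u i \<in> Hom (J i) (j i) (j' i) \<and>
           Comp E (\<rho> j' i) r = Comp E (far (D i) (u i)) (\<rho> j i)) \<and>
        (\<forall>i\<in>K - S. Comp E (\<rho> j' i) r = \<rho> j i) \<and>
        r \<in> Hom E (R j) (R j') \<longrightarrow> Comp E (g j') r = g j)"

lemma product_coconeI:
  assumes M: "is_product E K (\<lambda>i. if i \<in> S then Q i else W i) M \<mu>"
    and R: "\<And>j. (\<And>i. i \<in> S \<Longrightarrow> j i \<in> Ob (J i)) \<Longrightarrow>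
      is_product E K (\<lambda>i. if i \<in> S then fob (D i) (j i) else W i) (R j) (\<rho> j)"
    and t: "\<And>j. (\<And>i. i \<in> S \<Longrightarrow> j i \<in> Ob (J i)) \<Longrightarrow> t j \<in> Hom E (R j) M"
    and tS: "\<And>j i. (\<And>i. i \<in> S \<Longrightarrow> j i \<in> Ob (J i)) \<Longrightarrow> i \<in> S \<Longrightarrow>
      Comp E (\<mu> i) (t j) = Comp E (\<iota> i (j i)) (\<rho> j i)"
    and tW: "\<And>j i. (\<And>i. i \<in> S \<Longrightarrow> j i \<in> Ob (J i)) \<Longrightarrow> i \<in> K - S \<Longrightarrow>
      Comp E (\<mu> i) (t j) = \<rho> j i"
    and g: "\<And>j. (\<And>i. i \<in> S \<Longrightarrow> j i \<in> Ob (J i)) \<Longrightarrow> g j \<in> Hom E (R j) Y"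
    and compat: "\<And>j j' u r. (\<And>i. i \<in> S \<Longrightarrow> j i \<in> Ob (J i)) \<Longrightarrow>
      (\<And>i. i \<in> S \<Longrightarrow> j' i \<in> Ob (J i)) \<Longrightarrow>
      (\<And>i. i \<in> S \<Longrightarrow> u i \<in> Hom (J i) (j i) (j' i)) \<Longrightarrow> r \<in> Hom E (R j) (R j') \<Longrightarrow>
      (\<And>i. i \<in> S \<Longrightarrow> Comp E (\<rho> j' i) r = Comp E (far (D i) (u i)) (\<rho> j i)) \<Longrightarrow>
      (\<And>i. i \<in> K - S \<Longrightarrow> Comp E (\<rho> j' i) r = \<rho> j i) \<Longrightarrow> Comp E (g j') r = g j"
  shows "product_cocone E K J D Q \<iota> Y S W M \<mu> R \<rho> t g"
  unfolding product_cocone_def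
proof (intro conjI allI impI ballI M)
  fix j assume "\<forall>i\<in>S. j i \<in> Ob (J i)"
  then have j: "\<And>i. i \<in> S \<Longrightarrow> j i \<in> Ob (J i)" by simp
  show "is_product E K (\<lambda>i. if i \<in> S then fob (D i) (j i) else W i) (R j) (\<rho> j)"
    using j by (rule R)
  show "t j \<in> Hom E (R j) M" using j by (rule t)
  show "g j \<in> Hom E (R j) Y" using j by (rule g)
  show "Comp E (\<mu> i) (t j) = Comp E (\<iota> i (j i)) (\<rho> j i)" if "i \<in> S" for i using j that by (rule tS)
  show "Comp E (\<mu> i) (t j) = \<rho> j i" if "i \<in> K - S" for i using j that by (rule tW)
qed (rule compat; blast)

lemma product_coconeD:
  assumes "product_cocone E K J D Q \<iota> Y S W M \<mu> R \<rho> t g"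
  shows "is_product E K (\<lambda>i. if i \<in> S then Q i else W i) M \<mu>"
    and "\<And>j. (\<And>i. i \<in> S \<Longrightarrow> j i \<in> Ob (J i)) \<Longrightarrow>
      is_product E K (\<lambda>i. if i \<in> S then fob (D i) (j i) else W i) (R j) (\<rho> j)"
    and "\<And>j. (\<And>i. i \<in> S \<Longrightarrow> j i \<in> Ob (J i)) \<Longrightarrow> t j \<in> Hom E (R j) M"
    and "\<And>j i. (\<And>i. i \<in> S \<Longrightarrow> j i \<in> Ob (J i)) \<Longrightarrow> i \<in> S \<Longrightarrow>
      Comp E (\<mu> i) (t j) = Comp E (\<iota> i (j i)) (\<rho> j i)"
    and "\<And>j i. (\<And>i. i \<in> S \<Longrightarrow> j i \<in> Ob (J i)) \<Longrightarrow> i \<in> K - S \<Longrightarrow>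
      Comp E (\<mu> i) (t j) = \<rho> j i"
    and "\<And>j. (\<And>i. i \<in> S \<Longrightarrow> j i \<in> Ob (J i)) \<Longrightarrow> g j \<in> Hom E (R j) Y"
    and "\<And>j j' u r. (\<And>i. i \<in> S \<Longrightarrow> j i \<in> Ob (J i)) \<Longrightarrow>
      (\<And>i. i \<in> S \<Longrightarrow> j' i \<in> Ob (J i)) \<Longrightarrow>
      (\<And>i. i \<in> S \<Longrightarrow> u i \<in> Hom (J i) (j i) (j' i)) \<Longrightarrow> r \<in> Hom E (R j) (R j') \<Longrightarrow>
      (\<And>i. i \<in> S \<Longrightarrow> Comp E (\<rho> j' i) r = Comp E (far (D i) (u i)) (\<rho> j i)) \<Longrightarrow>
      (\<And>i. i \<in> K - S \<Longrightarrow> Comp E (\<rho> j' i) r = \<rho> j i) \<Longrightarrow> Comp E (g j') r = g j"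
  using assms unfolding product_cocone_def by blast+

text \<open>Induction on \<open>S\<close>: with one more variable \<open>k\<close>, the induction hypothesis is applied with
  \<open>W k\<close> fixed to each \<open>D k l\<close>; the arrows so obtained form a cocone in the single variable \<open>l\<close>.\<close>

lemma product_colimit:
  fixes \<kappa> :: "'u rel" and J :: "'i \<Rightarrow> ('j, 'k) cat"
  assumes \<kappa>: "Card_order \<kappa>" and "category E" and fp: "has_finite_products E"
    and ppc: "products_preserve_small_colimits \<kappa> E"
    and J: "\<And>i. i \<in> K \<Longrightarrow> category (J i)" "\<And>i. i \<in> K \<Longrightarrow> small_cat \<kappa> (J i)"
      "\<And>i. i \<in> K \<Longrightarrow> is_functor (J i) E (D i)"
    and Q: "\<And>i. i \<in> K \<Longrightarrow> is_colimit (J i) E (D i) (Q i) (\<iota> i)"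
    and K: "finite K" and S: "finite S" "S \<subseteq> K" and Y: "Y \<in> Ob E"
    and cocone: "product_cocone E K J D Q \<iota> Y S W M \<mu> R \<rho> t g"
  shows "\<exists>!h. h \<in> Hom E M Y \<and> (\<forall>j. (\<forall>i\<in>S. j i \<in> Ob (J i)) \<longrightarrow> Comp E h (t j) = g j)"
  using S cocone
proof (induction S arbitrary: W M \<mu> R \<rho> t g rule: finite_induct)
  interpret E: category E by fact
  case empty
  note pc = product_coconeD[OF empty.prems(2)]
  note M = pc(1) and R = pc(2) and t = pc(3) and tW = pc(5) and g = pc(6) and compat = pc(7)
  \<comment> \<open>No variable is left, so \<open>M\<close> and all \<open>R j\<close> are products
    of the same factors \<open>W i\<close>, yet \<open>j\<close> still runs through all functions.
    An arbitrary \<open>j0\<close> provides the candidate, and \<open>compat\<close> for the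
    comparison arrow from \<open>R j\<close> to \<open>R j0\<close> shows that it serves every
    \<open>j\<close>.\<close>
  fix j0 :: "'i \<Rightarrow> 'j"
  have R: "is_product E K W (R j) (\<rho> j)" and t: "t j \<in> Hom E (R j) M"
    and g: "g j \<in> Hom E (R j) Y" for j
    using R t g by simp_all
  have M: "is_product E K W M \<mu>" using M by simp
  obtain \<alpha> \<beta> where \<alpha>: "\<alpha> \<in> Hom E (R j0) M" "\<beta> \<in> Hom E M (R j0)"
    "Comp E \<alpha> \<beta> = Idn E M" "Comp E \<beta> \<alpha> = Idn E (R j0)"
    "\<And>i. i \<in> K \<Longrightarrow> Comp E (\<mu> i) \<alpha> = \<rho> j0 i" "\<And>i. i \<in> K \<Longrightarrow> Comp E (\<rho> j0 i) \<beta> = \<mu> i"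
    using E.is_product_iso[OF R[of j0] M] by metis
  have "t j0 = \<alpha>"
    using \<alpha>(5) tW by (intro E.is_product_ext[OF M t \<alpha>(1)]) auto
  have *: "Comp E (Comp E (g j0) \<beta>) (t j) = g j" for j
  proof -
    have "Comp E (g j0) (Comp E \<beta> (t j)) = g j"
    proof (rule compat[of j j0])
      show "Comp E \<beta> (t j) \<in> Hom E (R j) (R j0)" using t \<alpha>(2) by (rule E.comp_in_Hom)
      fix i assume "i \<in> K - {}"
      then have i: "i \<in> K" by simp
      have "Comp E (\<rho> j0 i) (Comp E \<beta> (t j)) = Comp E (Comp E (\<rho> j0 i) \<beta>) (t j)"
        using t[of j] \<alpha>(2) is_product_proj[OF R i, of j0] by (simp add: E.arrow_simps)
      then show "Comp E (\<rho> j0 i) (Comp E \<beta> (t j)) = \<rho> j i" using \<alpha>(6)[OF i] tW i by simp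
    qed auto
    then show ?thesis using t[of j] \<alpha>(2) g[of j0] by (simp add: E.arrow_simps)
  qed
  show ?case
  proof (intro ex1I[of _ "Comp E (g j0) \<beta>"] conjI allI impI *)
    show "Comp E (g j0) \<beta> \<in> Hom E M Y" using \<alpha>(2) g by (rule E.comp_in_Hom)
    fix h assume h: "h \<in> Hom E M Y \<and> (\<forall>j. (\<forall>i\<in>{}. j i \<in> Ob (J i)) \<longrightarrow> Comp E h (t j) = g j)"
    then have "Comp E h \<alpha> = g j0" using \<open>t j0 = \<alpha>\<close> by auto
    then show "h = Comp E (g j0) \<beta>" using E.cancel_iso(2)[OF \<alpha>(2,1,3)] h by metis
  qed
next
  interpret E: category E by fact
  case (insert k S)
  note kS = \<open>k \<notin> S\<close>
  have kK: "k \<in> K" and SK: "S \<subseteq> K" using insert.prems(1) by auto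
  note pc = product_coconeD[OF insert.prems(2)]
  note M = pc(1) and R = pc(2) and t = pc(3) and tS = pc(4) and tW = pc(5) and g = pc(6)
    and compat = pc(7)
  interpret J: category "J k" by (rule J(1)[OF kK])
  have cocone: "is_cocone (J i) E (D i) (Q i) (\<iota> i)" if "i \<in> K" for i
    using Q[OF that] by (simp add: is_colimit_def)
  have QOb: "Q i \<in> Ob E" if "i \<in> K" for i using cocone[OF that] by (simp add: is_cocone_def)
  have \<iota>: "\<iota> i l \<in> Hom E (fob (D i) l) (Q i)" if "i \<in> K" "l \<in> Ob (J i)" for i l
    using cocone[OF that(1)] that(2) by (simp add: is_cocone_def)
  have DOb: "fob (D i) l \<in> Ob E" if "i \<in> K" "l \<in> Ob (J i)" for i l
    using functor_ob[OF J(3)] that by blast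
  have Dhom: "far (D k) v \<in> Hom E (fob (D k) (Dom (J k) v)) (fob (D k) (Cod (J k) v))"
    if "v \<in> Ar (J k)" for v
    using that by (intro functor_Hom[OF J(3)[OF kK]]) (auto simp: J.arrow_simps)
  have WOb: "W i \<in> Ob E" if "i \<in> K - insert k S" for i
    using E.Hom_Ob[OF is_product_proj[OF M, of i]] that by auto
  let ?W = "\<lambda>l. W(k := fob (D k) l)"
  have "\<exists>M' \<mu>'. is_product E K (\<lambda>i. if i \<in> S then Q i else ?W l i) M' \<mu>'" if "l \<in> Ob (J k)" for l
  proof -
    have "(if i \<in> S then Q i else ?W l i) \<in> Ob E" if "i \<in> K" for i
      using QOb[OF that] WOb[of i] DOb[OF kK \<open>l \<in> Ob (J k)\<close>] that by auto
    then show ?thesis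
      using finite_product_exists[OF fp K, of "\<lambda>i. if i \<in> S then Q i else ?W l i"] by blast
  qed
  \<comment> \<open>\<open>M' l\<close> has passed to the colimit in the variables of
    \<open>S\<close> but not yet in \<open>k\<close>. The arrows \<open>t'\<close> below are its
    coprojections, and \<open>s\<close> leads from it to \<open>M\<close>.\<close>
  then obtain M' \<mu>' where M': "\<And>l. l \<in> Ob (J k) \<Longrightarrow>
      is_product E K (\<lambda>i. if i \<in> S then Q i else ?W l i) (M' l) (\<mu>' l)"
    by metis
  have R': "is_product E K (\<lambda>i. if i \<in> S then fob (D i) (j i) else ?W l i) (R (j(k := l))) (\<rho> (j(k := l)))"
    if l: "l \<in> Ob (J k)" and j: "\<And>i. i \<in> S \<Longrightarrow> j i \<in> Ob (J i)" for l j
  proof -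
    have "(\<lambda>i. if i \<in> insert k S then fob (D i) ((j(k := l)) i) else W i) =
        (\<lambda>i. if i \<in> S then fob (D i) (j i) else ?W l i)"
      using kS by auto
    moreover have "is_product E K (\<lambda>i. if i \<in> insert k S then fob (D i) ((j(k := l)) i) else W i)
        (R (j(k := l))) (\<rho> (j(k := l)))"
      by (rule R) (use l j in auto)
    ultimately show ?thesis by (simp only:)
  qed
  have "\<exists>t'. t' \<in> Hom E (R (j(k := l))) (M' l) \<and>
      (\<forall>i\<in>K. Comp E (\<mu>' l i) t' = (if i \<in> S then Comp E (\<iota> i (j i)) (\<rho> (j(k := l)) i) else \<rho> (j(k := l)) i))"
    if l: "l \<in> Ob (J k)" and j: "\<And>i. i \<in> S \<Longrightarrow> j i \<in> Ob (J i)" for l j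
  proof -
    let ?f = "\<lambda>i. if i \<in> S then Comp E (\<iota> i (j i)) (\<rho> (j(k := l)) i) else \<rho> (j(k := l)) i"
    have "?f i \<in> Hom E (R (j(k := l))) (if i \<in> S then Q i else ?W l i)" if i: "i \<in> K" for i
    proof (cases "i \<in> S")
      case True
      then show ?thesis
        using E.comp_in_Hom[OF _ \<iota>[OF i j]] is_product_proj[OF R'[OF l j] i] by simp
    next
      case False
      then show ?thesis using is_product_proj[OF R'[OF l j] i] by simp
    qed
    then show ?thesis
      using is_product_tuple[OF M'[OF l] is_product_Ob[OF R'[OF l j]], where f = ?f] by metis
  qed
  then obtain t' where t': "\<And>l j. l \<in> Ob (J k) \<Longrightarrow> (\<And>i. i \<in> S \<Longrightarrow> j i \<in> Ob (J i)) \<Longrightarrow>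
      t' l j \<in> Hom E (R (j(k := l))) (M' l) \<and>
      (\<forall>i\<in>K. Comp E (\<mu>' l i) (t' l j) =
        (if i \<in> S then Comp E (\<iota> i (j i)) (\<rho> (j(k := l)) i) else \<rho> (j(k := l)) i))"
    by metis
  note t'1 = conjunct1[OF t'] and t'2 = bspec[OF conjunct2[OF t']]
  have IH: "\<exists>!h. h \<in> Hom E (M' l) Y \<and>
      (\<forall>j. (\<forall>i\<in>S. j i \<in> Ob (J i)) \<longrightarrow> Comp E h (t' l j) = g (j(k := l)))" if l: "l \<in> Ob (J k)" for l
  proof (rule insert.IH[OF SK], rule product_coconeI[where W = "?W l" and \<mu> = "\<mu>' l" and
        R = "\<lambda>j. R (j(k := l))" and \<rho> = "\<lambda>j. \<rho> (j(k := l))"])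
    show "is_product E K (\<lambda>i. if i \<in> S then Q i else ?W l i) (M' l) (\<mu>' l)" using l by (rule M')
    fix j assume j: "\<And>i. i \<in> S \<Longrightarrow> j i \<in> Ob (J i)"
    show "is_product E K (\<lambda>i. if i \<in> S then fob (D i) (j i) else ?W l i) (R (j(k := l))) (\<rho> (j(k := l)))"
      using l j by (rule R')
    show "t' l j \<in> Hom E (R (j(k := l))) (M' l)" using l j by (rule t'1)
    show "g (j(k := l)) \<in> Hom E (R (j(k := l))) Y" by (rule g) (use l j in auto)
    show "Comp E (\<mu>' l i) (t' l j) = Comp E (\<iota> i (j i)) (\<rho> (j(k := l)) i)" if "i \<in> S" for i
      using t'2[OF l j, of i] that SK by auto
    show "Comp E (\<mu>' l i) (t' l j) = \<rho> (j(k := l)) i" if "i \<in> K - S" for i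
      using t'2[OF l j, of i] that by auto
    fix j' u r assume j': "\<And>i. i \<in> S \<Longrightarrow> j' i \<in> Ob (J i)"
      and u: "\<And>i. i \<in> S \<Longrightarrow> u i \<in> Hom (J i) (j i) (j' i)"
      and r: "r \<in> Hom E (R (j(k := l))) (R (j'(k := l)))"
      and rS: "\<And>i. i \<in> S \<Longrightarrow>
        Comp E (\<rho> (j'(k := l)) i) r = Comp E (far (D i) (u i)) (\<rho> (j(k := l)) i)"
      and rW: "\<And>i. i \<in> K - S \<Longrightarrow> Comp E (\<rho> (j'(k := l)) i) r = \<rho> (j(k := l)) i"
    show "Comp E (g (j'(k := l))) r = g (j(k := l))"
    \<comment> \<open>Naturality in the variables \<open>insert k S\<close> wants an arrow at
      \<open>k\<close> too: the identity, as \<open>l\<close> stays fixed.\<close>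
    proof (rule compat[where u = "u(k := Idn (J k) l)"])
      show "r \<in> Hom E (R (j(k := l))) (R (j'(k := l)))" by (rule r)
      fix i
      show "Comp E (\<rho> (j'(k := l)) i) r = \<rho> (j(k := l)) i" if "i \<in> K - insert k S"
        using rW that by blast
      have "far (D k) (Idn (J k) l) = Idn E (fob (D k) l)" using functor_id[OF J(3)[OF kK] l] .
      moreover have "\<rho> (j(k := l)) k \<in> Hom E (R (j(k := l))) (fob (D k) l)"
        using is_product_proj[OF R'[OF l j] kK] kS by simp
      ultimately have "Comp E (far (D k) (Idn (J k) l)) (\<rho> (j(k := l)) k) = \<rho> (j(k := l)) k"
        by (simp add: E.arrow_simps)
      then show "Comp E (\<rho> (j'(k := l)) i) r =
          Comp E (far (D i) ((u(k := Idn (J k) l)) i)) (\<rho> (j(k := l)) i)" if "i \<in> insert k S"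
        using rS[of i] rW[of k] that kS kK by (cases "i = k") simp_all
    qed (use j j' u l kS in \<open>auto simp: J.id_in_Hom\<close>)
  qed
  then obtain h where h: "\<And>l. l \<in> Ob (J k) \<Longrightarrow> h l \<in> Hom E (M' l) Y"
    "\<And>l j. l \<in> Ob (J k) \<Longrightarrow> (\<And>i. i \<in> S \<Longrightarrow> j i \<in> Ob (J i)) \<Longrightarrow> Comp E (h l) (t' l j) = g (j(k := l))"
    by metis
  have h_unique: "x = h l" if l: "l \<in> Ob (J k)" and x: "x \<in> Hom E (M' l) Y"
    "\<And>j. (\<And>i. i \<in> S \<Longrightarrow> j i \<in> Ob (J i)) \<Longrightarrow> Comp E x (t' l j) = g (j(k := l))" for l x
    using IH[OF l] h[OF l] x by metis
  let ?A = "\<lambda>i. if i \<in> S then Q i else W i"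
  have insertK: "insert k (K - {k}) = K" using kK by auto
  have A_Q: "?A(k := Q k) = (\<lambda>i. if i \<in> insert k S then Q i else W i)" using kS by auto
  have A_D: "?A(k := fob (D k) l) = (\<lambda>i. if i \<in> S then Q i else ?W l i)" for l using kS by auto
  have "\<exists>s. s \<in> Hom E (M' l) M \<and>
      (\<forall>i\<in>K. Comp E (\<mu> i) s = (if i = k then Comp E (\<iota> k l) (\<mu>' l k) else \<mu>' l i))"
    if l: "l \<in> Ob (J k)" for l
  proof -
    let ?f = "\<lambda>i. if i = k then Comp E (\<iota> k l) (\<mu>' l k) else \<mu>' l i"
    have "?f i \<in> Hom E (M' l) (if i \<in> insert k S then Q i else W i)" if i: "i \<in> K" for i
      using is_product_proj[OF M'[OF l] i] E.comp_in_Hom[OF _ \<iota>[OF kK l]] kS by auto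
    then show ?thesis
      using is_product_tuple[OF M is_product_Ob[OF M'[OF l]], where f = ?f] by metis
  qed
  then obtain s where s: "\<And>l. l \<in> Ob (J k) \<Longrightarrow> s l \<in> Hom E (M' l) M"
    "\<And>l i. l \<in> Ob (J k) \<Longrightarrow> i \<in> K \<Longrightarrow>
      Comp E (\<mu> i) (s l) = (if i = k then Comp E (\<iota> k l) (\<mu>' l k) else \<mu>' l i)"
    by metis
  \<comment> \<open>Now the single variable \<open>k\<close>. The arrows \<open>h l\<close> have to
    be natural in \<open>l\<close>; the uniqueness part of the induction hypothesis reduces this to
    a check after each \<open>t' l j\<close>.\<close>
  have ex: "\<exists>!x. x \<in> Hom E M Y \<and> (\<forall>l\<in>Ob (J k). Comp E x (s l) = h l)"
  proof (rule product_colimit_one_variable[OF \<kappa> \<open>category E\<close> fp ppc J[OF kK] Q[OF kK], where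
        K = "K - {k}" and k = k and A = ?A and \<mu> = \<mu> and R = M' and \<rho> = \<mu>'])
    show "is_product E (insert k (K - {k})) (?A(k := Q k)) M \<mu>"
      unfolding insertK A_Q by (rule M)
    show "is_product E (insert k (K - {k})) (?A(k := fob (D k) l)) (M' l) (\<mu>' l)"
      if "l \<in> Ob (J k)" for l
      unfolding insertK A_D using that by (rule M')
  next
    fix v r
    let ?l = "Dom (J k) v" and ?l' = "Cod (J k) v"
    assume v: "v \<in> Ar (J k)" and r: "r \<in> Hom E (M' ?l) (M' ?l')"
      and rK: "\<forall>i\<in>K - {k}. Comp E (\<mu>' ?l' i) r = \<mu>' ?l i"
      and rk: "Comp E (\<mu>' ?l' k) r = Comp E (far (D k) v) (\<mu>' ?l k)"
    have l: "?l \<in> Ob (J k)" "?l' \<in> Ob (J k)" using v by (auto simp: J.arrow_simps)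
    show "Comp E (h ?l') r = h ?l"
    proof (rule h_unique[OF l(1)])
      show "Comp E (h ?l') r \<in> Hom E (M' ?l) Y" using r h(1)[OF l(2)] by (rule E.comp_in_Hom)
      fix j assume j: "\<And>i. i \<in> S \<Longrightarrow> j i \<in> Ob (J i)"
      let ?j = "j(k := ?l)" and ?j' = "j(k := ?l')"
      note pr = is_product_proj[OF R'[OF l(1) j]] and pr' = is_product_proj[OF R'[OF l(2) j]]
        and pm' = is_product_proj[OF M'[OF l(2)]] and pm = is_product_proj[OF M'[OF l(1)]]
      \<comment> \<open>Components of the arrow \<open>r'\<close> between the products
        \<open>R\<close> that lies over \<open>r\<close>: \<open>far (D k) v\<close> at
        \<open>k\<close>, nothing changed elsewhere.\<close>
      let ?f = "\<lambda>i. if i = k then Comp E (far (D k) v) (\<rho> ?j k) else \<rho> ?j i"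
      have "?f i \<in> Hom E (R ?j) (if i \<in> S then fob (D i) (j i) else ?W ?l' i)" if i: "i \<in> K" for i
        using pr[of i] i j kS E.comp_in_Hom[OF _ Dhom[OF v]] by auto
      then obtain r' where r': "r' \<in> Hom E (R ?j) (R ?j')"
          "\<And>i. i \<in> K \<Longrightarrow> Comp E (\<rho> ?j' i) r' = ?f i"
        using is_product_tuple[OF R'[OF l(2) j] is_product_Ob[OF R'[OF l(1) j]], where f = ?f] by metis
      note hom = r r'(1) t'1[OF l(1) j] t'1[OF l(2) j] h(1)[OF l(2)] Dhom[OF v]
      have "Comp E r (t' ?l j) = Comp E (t' ?l' j) r'"
      proof (rule E.is_product_ext[OF M'[OF l(2)]])
        show "Comp E r (t' ?l j) \<in> Hom E (R ?j) (M' ?l')" "Comp E (t' ?l' j) r' \<in> Hom E (R ?j) (M' ?l')"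
          using hom j by (auto intro: E.comp_in_Hom)
        fix i assume i: "i \<in> K"
        have "Comp E (\<mu>' ?l' i) (Comp E r (t' ?l j)) = Comp E (Comp E (\<mu>' ?l' i) r) (t' ?l j)"
          using hom j pm'[OF i] by (simp add: E.arrow_simps)
        also have "\<dots> = Comp E (Comp E (\<mu>' ?l' i) (t' ?l' j)) r'"
        proof (cases "i = k")
          case True
          then show ?thesis
            using rk hom j pm[OF kK] pr'[of k] t'2[OF l(1) j kK] t'2[OF l(2) j kK] r'(2)[OF kK] kS
            by (simp add: E.arrow_simps)
        next
          case False
          then have "Comp E (Comp E (\<mu>' ?l' i) r) (t' ?l j) = Comp E (\<mu>' ?l i) (t' ?l j)"
            using rK i by simp
          also have "\<dots> = Comp E (if i \<in> S then Comp E (\<iota> i (j i)) (\<rho> ?j' i) else \<rho> ?j' i) r'"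
            using False r'(2)[OF i] t'2[OF l(1) j i] hom pr'[of i] \<iota>[OF i] i j
            by (simp add: E.arrow_simps)
          finally show ?thesis using t'2[OF l(2) j i] by simp
        qed
        also have "\<dots> = Comp E (\<mu>' ?l' i) (Comp E (t' ?l' j) r')"
          using hom j pm'[OF i] by (simp add: E.arrow_simps)
        finally show "Comp E (\<mu>' ?l' i) (Comp E r (t' ?l j)) = Comp E (\<mu>' ?l' i) (Comp E (t' ?l' j) r')" .
      qed
      then have "Comp E (Comp E (h ?l') r) (t' ?l j) = Comp E (Comp E (h ?l') (t' ?l' j)) r'"
        using hom j by (simp add: E.arrow_simps)
      also have "\<dots> = Comp E (g ?j') r'" using h(2)[OF l(2) j] by simp
      also have "\<dots> = g ?j"
      proof (rule compat[where u = "(\<lambda>i. Idn (J i) (j i))(k := v)"])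
        show "r' \<in> Hom E (R ?j) (R ?j')" by (rule r'(1))
        fix i
        show "Comp E (\<rho> ?j' i) r' = \<rho> ?j i" if "i \<in> K - insert k S"
          using r'(2)[of i] that by auto
        show "Comp E (\<rho> ?j' i) r' = Comp E (far (D i) (((\<lambda>i. Idn (J i) (j i))(k := v)) i)) (\<rho> ?j i)"
          if "i \<in> insert k S"
        proof (cases "i = k")
          case False
          then have i: "i \<in> S" "i \<in> K" using that SK by auto
          then show ?thesis
            using False r'(2)[OF i(2)] functor_id[OF J(3)[OF i(2)] j[OF i(1)]] pr[of i] j
            by (simp add: E.arrow_simps)
        qed (use r'(2)[OF kK] in simp)
        show "((\<lambda>i. Idn (J i) (j i))(k := v)) i \<in> Hom (J i) (?j i) (?j' i)" if "i \<in> insert k S"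
          using that SK j v category.id_in_Hom[OF J(1)] by (auto simp: in_Hom_iff)
      qed (use l j in auto)
      finally show "Comp E (Comp E (h ?l') r) (t' ?l j) = g ?j" .
    qed
  qed (use K Y h(1) s kK in auto)
  \<comment> \<open>Passing to the colimit in all variables is passing to it in those of
    \<open>S\<close> and then in \<open>k\<close>.\<close>
  have decomp: "t j = Comp E (s (j k)) (t' (j k) j)"
    if j: "\<And>i. i \<in> insert k S \<Longrightarrow> j i \<in> Ob (J i)" for j
  proof (rule E.is_product_ext[OF M])
    have jk: "j k \<in> Ob (J k)" and jS: "\<And>i. i \<in> S \<Longrightarrow> j i \<in> Ob (J i)" using j by auto
    note t'j = t'1[OF jk jS] t'2[OF jk jS]
    show "t j \<in> Hom E (R j) M" using j by (rule t)
    show "Comp E (s (j k)) (t' (j k) j) \<in> Hom E (R j) M"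
      using t'j(1) s(1)[OF jk] jS by (auto intro: E.comp_in_Hom)
    fix i assume i: "i \<in> K"
    note pm = is_product_proj[OF M'[OF jk]] is_product_proj[OF M]
    have "Comp E (\<mu> i) (Comp E (s (j k)) (t' (j k) j)) = Comp E (Comp E (\<mu> i) (s (j k))) (t' (j k) j)"
      using t'j(1) s(1)[OF jk] jS pm(2)[OF i] by (simp add: E.arrow_simps)
    also have "\<dots> = Comp E (\<mu> i) (t j)"
      using s(2)[OF jk i] t'j(2)[of i] jS i kS kK tS[OF j, of i] tW[OF j, of i] j jk
        t'j(1) \<iota>[OF kK jk] pm(1)[OF kK]
      by (auto simp: E.arrow_simps)
    finally show "Comp E (\<mu> i) (t j) = Comp E (\<mu> i) (Comp E (s (j k)) (t' (j k) j))" by simp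
  qed
  \<comment> \<open>Both conditions select the same arrows out of \<open>M\<close>, so the unique
    one found for the variable \<open>k\<close> is the one sought.\<close>
  have iff: "(\<forall>j. (\<forall>i\<in>insert k S. j i \<in> Ob (J i)) \<longrightarrow> Comp E x (t j) = g j) \<longleftrightarrow>
      (\<forall>l\<in>Ob (J k). Comp E x (s l) = h l)" if x: "x \<in> Hom E M Y" for x
  proof
    assume *: "\<forall>j. (\<forall>i\<in>insert k S. j i \<in> Ob (J i)) \<longrightarrow> Comp E x (t j) = g j"
    show "\<forall>l\<in>Ob (J k). Comp E x (s l) = h l"
    proof
      fix l assume l: "l \<in> Ob (J k)"
      show "Comp E x (s l) = h l"
      proof (rule h_unique[OF l E.comp_in_Hom[OF s(1)[OF l] x]])
        fix j assume j: "\<And>i. i \<in> S \<Longrightarrow> j i \<in> Ob (J i)"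
        let ?j = "j(k := l)"
        have j': "\<And>i. i \<in> S \<Longrightarrow> ?j i \<in> Ob (J i)" using j l by auto
        \<comment> \<open>\<open>t'\<close> was chosen separately for every function
          \<open>j\<close>, including its value at \<open>k\<close>. Its components do not see that
          value, since \<open>k\<close> lies outside \<open>S\<close>.\<close>
        have "t' l ?j = t' l j"
        proof (rule E.is_product_ext[OF M'[OF l]])
          show "t' l ?j \<in> Hom E (R ?j) (M' l)" using t'1[OF l, of ?j] j' by simp
          show "t' l j \<in> Hom E (R ?j) (M' l)" using t'1[OF l, of j] j by simp
          fix i assume "i \<in> K"
          then show "Comp E (\<mu>' l i) (t' l ?j) = Comp E (\<mu>' l i) (t' l j)"
            using t'2[OF l, of ?j i] t'2[OF l, of j i] j j' kS by auto
        qed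
        moreover have jl: "?j i \<in> Ob (J i)" if "i \<in> insert k S" for i using that j l by auto
        have "t ?j = Comp E (s (?j k)) (t' (?j k) ?j)" by (rule decomp) (rule jl)
        ultimately have tj: "t ?j = Comp E (s l) (t' l j)" by simp
        have "Comp E x (t ?j) = g ?j" by (rule *[rule_format]) (rule jl)
        then show "Comp E (Comp E x (s l)) (t' l j) = g ?j"
          using tj x s(1)[OF l] t'1[OF l j] by (simp add: E.arrow_simps)
      qed
    qed
  next
    assume *: "\<forall>l\<in>Ob (J k). Comp E x (s l) = h l"
    show "\<forall>j. (\<forall>i\<in>insert k S. j i \<in> Ob (J i)) \<longrightarrow> Comp E x (t j) = g j"
    proof (intro allI impI)
      fix j assume j: "\<forall>i\<in>insert k S. j i \<in> Ob (J i)"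
      then have jk: "j k \<in> Ob (J k)" and jS: "\<And>i. i \<in> S \<Longrightarrow> j i \<in> Ob (J i)" by auto
      have "Comp E x (t j) = Comp E (Comp E x (s (j k))) (t' (j k) j)"
        using decomp[of j] j x s(1)[OF jk] t'1[OF jk jS] by (simp add: E.arrow_simps)
      also have "\<dots> = g j" using * jk h(2)[OF jk jS] by simp
      finally show "Comp E x (t j) = g j" .
    qed
  qed
  show ?case using ex by (simp only: iff cong: conj_cong)
qed


section \<open>Pointwise left Kan extensions\<close>

lemma comma_sel:
  "Ob (comma B C F c) = {(b, z). b \<in> Ob B \<and> z \<in> Hom C (fob F b) c}"
  "Dom (comma B C F c) u = fst u" "Cod (comma B C F c) u = snd (snd u)"
  by (auto simp: comma_def split: prod.splits)

lemma comma_arrow: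
  "(x, f, y) \<in> Ar (comma B C F c) \<longleftrightarrow> x \<in> Ob (comma B C F c) \<and> y \<in> Ob (comma B C F c) \<and>
     f \<in> Hom B (fst x) (fst y) \<and> Comp C (snd y) (far F f) = snd x"
  by (auto simp: comma_def)

lemma comma_Ob_Hom:
  "x \<in> Ob (comma B C F c) \<Longrightarrow> fst x \<in> Ob B \<and> snd x \<in> Hom C (fob F (fst x)) c"
  by (auto simp: comma_sel)

text \<open>By regularity, a sum of fewer than \<kappa> sets of size below \<kappa> has size below
  \<kappa>. The objects form such a sum of hom sets over \<open>Ob B\<close>, and an arrow is a
  triple of two objects and an arrow of B.\<close>

lemma small_comma:
  fixes \<kappa> :: "'u rel"
  assumes \<kappa>: "Cinfinite \<kappa>" "regularCard \<kappa>" and B: "small_cat \<kappa> B"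
    and C: "locally_small_cat \<kappa> C" and F: "is_functor B C F" and c: "c \<in> Ob C"
  shows "small_cat \<kappa> (comma B C F c)"
proof -
  have st: "stable \<kappa>" using \<kappa> regularCard_stable unfolding cinfinite_def by blast
  let ?O = "Ob (comma B C F c)"
  have "?O = (SIGMA b : Ob B. Hom C (fob F b) c)" by (auto simp: comma_sel)
  moreover have "|SIGMA b : Ob B. Hom C (fob F b) c| <o \<kappa>"
    using B C c functor_ob[OF F] unfolding small_cat_def locally_small_cat_def
    by (intro stable_elim[OF st]) auto
  ultimately have O: "|?O| <o \<kappa>" by simp
  have "|SIGMA f : Ar B. ?O| <o \<kappa>"
    using B O unfolding small_cat_def by (intro stable_elim[OF st]) auto
  then have "|SIGMA x : ?O. SIGMA f : Ar B. ?O| <o \<kappa>" by (rule stable_elim[OF st O])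
  moreover have "Ar (comma B C F c) \<subseteq> (SIGMA x : ?O. SIGMA f : Ar B. ?O)"
    by (auto simp: comma_arrow in_Hom_iff)
  ultimately have "|Ar (comma B C F c)| <o \<kappa>"
    using ordLeq_ordLess_trans[OF card_of_mono1] by blast
  with O show ?thesis by (simp add: small_cat_def)
qed

text \<open>The colimit property leaves no freedom on arrows: \<open>ind\<close> is the equation
  that a value must satisfy. Identities and composites satisfy it as well, so the functor laws
  follow from uniqueness.\<close>

lemma kan_extension_exists:
  assumes "category E" "category C" "category B" and F: "is_functor B C F"
    and colim: "\<And>c. c \<in> Ob C \<Longrightarrow> \<exists>Q \<iota>. is_colimit (comma B C F c) E (fcomp X comma_forget) Q \<iota>"
  shows "\<exists>L \<iota>. is_left_kan_extension B C E F X L \<iota>"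
proof -
  interpret E: category E by fact
  interpret C: category C by fact
  interpret B: category B by fact
  let ?D = "fcomp X comma_forget"
  have "\<forall>c\<in>Ob C. \<exists>Q\<iota>. is_colimit (comma B C F c) E ?D (fst Q\<iota>) (snd Q\<iota>)"
    using colim by simp
  from bchoice[OF this] obtain f where
    f: "\<forall>c\<in>Ob C. is_colimit (comma B C F c) E ?D (fst (f c)) (snd (f c))" by blast
  define Q \<iota> where "Q c = fst (f c)" and "\<iota> c = snd (f c)" for c
  have Q: "is_colimit (comma B C F c) E ?D (Q c) (\<iota> c)" if "c \<in> Ob C" for c
    using f that by (simp add: Q_def \<iota>_def)
  then have cocone: "is_cocone (comma B C F c) E ?D (Q c) (\<iota> c)" if "c \<in> Ob C" for c
    using that by (simp add: is_colimit_def)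
  have QOb: "Q c \<in> Ob E" if "c \<in> Ob C" for c using cocone[OF that] by (simp add: is_cocone_def)
  have \<iota>: "\<iota> c x \<in> Hom E (fob X (fst x)) (Q c)" if "c \<in> Ob C" "x \<in> Ob (comma B C F c)" for c x
    using cocone[OF that(1)] that(2) by (simp add: is_cocone_def fcomp_def comma_forget_def)
  define ind where "ind c c' g h \<longleftrightarrow> h \<in> Hom E (Q c) (Q c') \<and>
      (\<forall>x\<in>Ob (comma B C F c). Comp E h (\<iota> c x) = \<iota> c' (fst x, Comp C g (snd x)))" for c c' g h
  have push: "(fst x, Comp C g (snd x)) \<in> Ob (comma B C F c')"
    if "g \<in> Hom C c c'" "x \<in> Ob (comma B C F c)" for c c' g x
    using that C.comp_in_Hom by (auto simp: comma_sel)
  have ex: "\<exists>!h. ind c c' g h" if g: "g \<in> Hom C c c'" for c c' g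
  proof -
    have c: "c \<in> Ob C" "c' \<in> Ob C" using C.Hom_Ob[OF g] by auto
    have "is_cocone (comma B C F c) E ?D (Q c') (\<lambda>x. \<iota> c' (fst x, Comp C g (snd x)))"
      unfolding is_cocone_def
    proof (intro conjI ballI QOb c)
      show "\<iota> c' (fst x, Comp C g (snd x)) \<in> Hom E (fob ?D x) (Q c')"
        if "x \<in> Ob (comma B C F c)" for x
        using \<iota>[OF c(2) push[OF g that]] by (simp add: fcomp_def comma_forget_def)
      fix v assume "v \<in> Ar (comma B C F c)"
      then obtain x u y where v: "v = (x, u, y)" "x \<in> Ob (comma B C F c)" "y \<in> Ob (comma B C F c)"
        "u \<in> Hom B (fst x) (fst y)" "Comp C (snd y) (far F u) = snd x"
        by (cases v) (simp add: comma_arrow)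
      \<comment> \<open>Composition with \<open>g\<close> carries \<open>F/c\<close> to
        \<open>F/c'\<close> over B: the same \<open>u\<close> is an arrow between the images, so the
        cocone equation of \<open>\<iota> c'\<close> applies to it.\<close>
      have "Comp C (Comp C g (snd y)) (far F u) = Comp C g (snd x)"
        using comma_Ob_Hom[OF v(2)] comma_Ob_Hom[OF v(3)] functor_Hom[OF F _ _ v(4)] g v(5)[symmetric]
        by (simp add: C.arrow_simps)
      then have "((fst x, Comp C g (snd x)), u, (fst y, Comp C g (snd y))) \<in> Ar (comma B C F c')"
        using push[OF g] v by (simp add: comma_arrow)
      then have "Comp E (\<iota> c' (fst y, Comp C g (snd y))) (far X u) = \<iota> c' (fst x, Comp C g (snd x))"
        using cocone[OF c(2)] unfolding is_cocone_def
        by (force simp: comma_sel fcomp_def comma_forget_def)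
      then show "Comp E (\<iota> c' (fst (Cod (comma B C F c) v), Comp C g (snd (Cod (comma B C F c) v)))) (far ?D v)
          = \<iota> c' (fst (Dom (comma B C F c) v), Comp C g (snd (Dom (comma B C F c) v)))"
        by (simp add: v(1) comma_sel fcomp_def comma_forget_def)
    qed
    then show ?thesis using Q[OF c(1)] unfolding is_colimit_def ind_def by blast
  qed
  \<comment> \<open>\<open>ind\<close> depends on the ends of the arrow, which are recovered from
    \<open>g\<close>; by \<open>ex\<close> the description is proper on arrows of C.\<close>
  define L where "L = \<lparr>fob = Q, far = (\<lambda>g. THE h. ind (Dom C g) (Cod C g) g h)\<rparr>"
  have L_ind: "ind c c' g (far L g)" if g: "g \<in> Hom C c c'" for c c' g
    using theI'[OF ex[OF g]] g by (simp add: L_def in_Hom_iff)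
  have L_eq: "far L g = h" if "g \<in> Hom C c c'" "ind c c' g h" for c c' g h
    using ex[OF that(1)] L_ind[OF that(1)] that(2) by blast
  have "is_functor C E L"
    unfolding is_functor_def
  proof (intro conjI ballI)
    show "fob L c \<in> Ob E" if "c \<in> Ob C" for c using QOb[OF that] by (simp add: L_def)
    show "far L g \<in> Hom E (fob L c) (fob L c')" if "g \<in> Hom C c c'" for c c' g
      using L_ind[OF that] by (simp add: ind_def) (simp add: L_def)
    show "far L (Idn C c) = Idn E (fob L c)" if c: "c \<in> Ob C" for c
    proof (rule L_eq[OF C.id_in_Hom[OF c]])
      show "ind c c (Idn C c) (Idn E (fob L c))"
        unfolding ind_def
      proof (intro conjI ballI)
        show "Idn E (fob L c) \<in> Hom E (Q c) (Q c)" using QOb[OF c] by (simp add: L_def E.id_in_Hom)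
        fix x assume x: "x \<in> Ob (comma B C F c)"
        show "Comp E (Idn E (fob L c)) (\<iota> c x) = \<iota> c (fst x, Comp C (Idn C c) (snd x))"
          using \<iota>[OF c x] comma_Ob_Hom[OF x] by (simp add: L_def in_Hom_iff E.comp_id C.comp_id)
      qed
    qed
    show "far L (Comp C g f) = Comp E (far L g) (far L f)"
      if f: "f \<in> Hom C a b" and g: "g \<in> Hom C b c" for a b c f g
    proof (rule L_eq[OF C.comp_in_Hom[OF f g]])
      have lf: "far L f \<in> Hom E (Q a) (Q b)" and lg: "far L g \<in> Hom E (Q b) (Q c)"
        using L_ind[OF f] L_ind[OF g] by (auto simp: ind_def)
      have Ob: "a \<in> Ob C" "b \<in> Ob C" using C.Hom_Ob f by auto
      show "ind a c (Comp C g f) (Comp E (far L g) (far L f))"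
        unfolding ind_def
      proof (intro conjI ballI E.comp_in_Hom[OF lf lg])
        fix x assume x: "x \<in> Ob (comma B C F a)"
        have "Comp E (Comp E (far L g) (far L f)) (\<iota> a x) = Comp E (far L g) (Comp E (far L f) (\<iota> a x))"
          using lf lg \<iota>[OF Ob(1) x] by (simp add: E.arrow_simps)
        also have "\<dots> = Comp E (far L g) (\<iota> b (fst x, Comp C f (snd x)))"
          using L_ind[OF f] x by (simp add: ind_def)
        also have "\<dots> = \<iota> c (fst x, Comp C g (Comp C f (snd x)))"
          using L_ind[OF g] push[OF f x] by (auto simp: ind_def)
        also have "\<dots> = \<iota> c (fst x, Comp C (Comp C g f) (snd x))"
          using comma_Ob_Hom[OF x] f g by (simp add: C.arrow_simps)
        finally show "Comp E (Comp E (far L g) (far L f)) (\<iota> a x) =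
          \<iota> c (fst x, Comp C (Comp C g f) (snd x))" .
      qed
    qed
  qed
  moreover have "is_colimit (comma B C F c) E ?D (fob L c) (\<iota> c)" if "c \<in> Ob C" for c
    using Q[OF that] by (simp add: L_def)
  moreover have "Comp E (far L g) (\<iota> c (b, z)) = \<iota> c' (b, Comp C g z)"
    if "g \<in> Hom C c c'" "(b, z) \<in> Ob (comma B C F c)" for c c' g b z
    using L_ind[OF that(1)] that(2) unfolding ind_def by fastforce
  ultimately have "is_left_kan_extension B C E F X L \<iota>"
    unfolding is_left_kan_extension_def by blast
  then show ?thesis by blast
qed

section \<open>Comparison of \<open>L P\<close> with the product of the
  \<open>L (A i)\<close>\<close>

lemma kan_extension_preserves_finite_products:
  fixes \<kappa> :: "'u rel"
  assumes \<kappa>: "Card_order \<kappa>" and "category E" and fp: "has_finite_products E"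
    and ppc: "products_preserve_small_colimits \<kappa> E"
    and "category C" "category B" and Bp: "has_finite_products B"
    and F: "is_functor B C F" and X: "is_functor B E X" and Xp: "preserves_finite_products B E X"
    and small: "\<And>c. c \<in> Ob C \<Longrightarrow> small_cat \<kappa> (comma B C F c)"
    and LK: "is_left_kan_extension B C E F X L \<iota>"
  shows "preserves_finite_products C E L"
  unfolding preserves_finite_products_def
proof (intro allI impI)
  interpret E: category E by fact
  interpret C: category C by fact
  interpret B: category B by fact
  fix n :: nat and A P \<pi> assume P: "is_product C {..<n} A P \<pi>"
  let ?D = "fcomp X comma_forget" and ?J = "comma B C F" and ?K = "{..<n}"
  have L: "is_functor C E L" using LK by (simp add: is_left_kan_extension_def)
  have colim: "is_colimit (?J c) E ?D (fob L c) (\<iota> c)" if "c \<in> Ob C" for c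
    using LK that by (simp add: is_left_kan_extension_def)
  then have cocone: "is_cocone (?J c) E ?D (fob L c) (\<iota> c)" if "c \<in> Ob C" for c
    using that by (simp add: is_colimit_def)
  have \<iota>: "\<iota> c x \<in> Hom E (fob X (fst x)) (fob L c)" if "c \<in> Ob C" "x \<in> Ob (?J c)" for c x
    using cocone[OF that(1)] that(2) by (simp add: is_cocone_def fcomp_def comma_forget_def)
  have nat: "Comp E (\<iota> c y) (far X u) = \<iota> c x"
    if "c \<in> Ob C" "x \<in> Ob (?J c)" "y \<in> Ob (?J c)" "u \<in> Hom B (fst x) (fst y)"
      "Comp C (snd y) (far F u) = snd x" for c x y u
  proof -
    have "(x, u, y) \<in> Ar (?J c)" using that by (simp add: comma_arrow)
    then show ?thesis
      using cocone[OF that(1)] unfolding is_cocone_def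
      by (force simp: comma_sel fcomp_def comma_forget_def)
  qed
  have L\<iota>: "Comp E (far L g) (\<iota> c x) = \<iota> c' (fst x, Comp C g (snd x))"
    if "g \<in> Hom C c c'" "x \<in> Ob (?J c)" for c c' g x
    using LK that C.Hom_Ob[OF that(1)] unfolding is_left_kan_extension_def by fastforce
  have POb: "P \<in> Ob C" using P by (rule is_product_Ob)
  note \<pi> = is_product_proj[OF P]
  have AOb: "A i \<in> Ob C" if "i \<in> ?K" for i using C.Hom_Ob[OF \<pi>[OF that]] by simp
  obtain Q \<rho> where Q: "is_product E ?K (\<lambda>i. fob L (A i)) Q \<rho>"
    using finite_product_exists[OF fp, of ?K "\<lambda>i. fob L (A i)"] functor_ob[OF L AOb] by auto
  note \<rho> = is_product_proj[OF Q]
  have L\<pi>: "far L (\<pi> i) \<in> Hom E (fob L P) (fob L (A i))" if "i \<in> ?K" for i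
    using functor_Hom[OF L POb AOb \<pi>] that by blast
  \<comment> \<open>The comparison arrow; what remains is to construct its inverse \<psi>.\<close>
  obtain \<phi> where \<phi>: "\<phi> \<in> Hom E (fob L P) Q" "\<And>i. i \<in> ?K \<Longrightarrow> Comp E (\<rho> i) \<phi> = far L (\<pi> i)"
    using is_product_tuple[OF Q functor_ob[OF L POb] L\<pi>] by metis

  \<comment> \<open>Only the values of \<open>w\<close> on the index set are constrained, yet
    \<open>b w\<close> and \<open>p w\<close> are chosen per function and may depend on the others.
    Naturality is therefore stated below for every \<open>v\<close> compatible with the
    projections.\<close>
  define ok where "ok w \<longleftrightarrow> (\<forall>i\<in>?K. w i \<in> Ob (?J (A i)))" for w
  have ok_Ob: "w i \<in> Ob (?J (A i))" "fst (w i) \<in> Ob B" "snd (w i) \<in> Hom C (fob F (fst (w i))) (A i)"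
    if "ok w" "i \<in> ?K" for w i
    using that comma_Ob_Hom[of "w i" B C F "A i"] unfolding ok_def by auto
  have "\<exists>b p. is_product B ?K (\<lambda>i. fst (w i)) b p" if "ok w" for w
    using finite_product_exists[OF Bp, of ?K "\<lambda>i. fst (w i)"] ok_Ob(2)[OF that] by blast
  then obtain b p where b: "\<And>w. ok w \<Longrightarrow> is_product B ?K (\<lambda>i. fst (w i)) (b w) (p w)"
    by metis
  note p = is_product_proj[OF b]
  have bOb: "b w \<in> Ob B" if "ok w" for w using b[OF that] by (rule is_product_Ob)
  have Xb: "is_product E ?K (\<lambda>i. fob X (fst (w i))) (fob X (b w)) (\<lambda>i. far X (p w i))"
    if "ok w" for w
    using Xp b[OF that] unfolding preserves_finite_products_def by blast
  note Xhom = functor_Hom[OF X] and Fhom = functor_Hom[OF F]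
  have Fp: "far F (p w i) \<in> Hom C (fob F (b w)) (fob F (fst (w i)))" if "ok w" "i \<in> ?K" for w i
    using Fhom[OF bOb[OF that(1)] ok_Ob(2)[OF that] p[OF that]] .
  have Xp': "far X (p w i) \<in> Hom E (fob X (b w)) (fob X (fst (w i)))" if "ok w" "i \<in> ?K" for w i
    using Xhom[OF bOb[OF that(1)] ok_Ob(2)[OF that] p[OF that]] .
  have "\<exists>z. z \<in> Hom C (fob F (b w)) P \<and> (\<forall>i\<in>?K. Comp C (\<pi> i) z = Comp C (snd (w i)) (far F (p w i)))"
    if w: "ok w" for w
  proof -
    have "Comp C (snd (w i)) (far F (p w i)) \<in> Hom C (fob F (b w)) (A i)" if "i \<in> ?K" for i
      using C.comp_in_Hom[OF Fp[OF w that] ok_Ob(3)[OF w that]] .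
    then show ?thesis by (rule is_product_tuple[OF P functor_ob[OF F bOb[OF w]]]) blast+
  qed
  then obtain \<zeta> where \<zeta>: "\<And>w. ok w \<Longrightarrow> \<zeta> w \<in> Hom C (fob F (b w)) P"
    "\<And>w i. ok w \<Longrightarrow> i \<in> ?K \<Longrightarrow> Comp C (\<pi> i) (\<zeta> w) = Comp C (snd (w i)) (far F (p w i))"
    by metis
  have \<zeta>Ob: "(b w, \<zeta> w) \<in> Ob (?J P)" if "ok w" for w
    using \<zeta>(1)[OF that] bOb[OF that] by (simp add: comma_sel)
  have \<iota>w: "\<iota> (A i) (w i) \<in> Hom E (fob X (fst (w i))) (fob L (A i))" if "ok w" "i \<in> ?K" for w i
    using \<iota>[OF AOb[OF that(2)] ok_Ob(1)[OF that]] .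
  \<comment> \<open>\<open>t w\<close> is the product of the coprojections at the
    \<open>w i\<close>; its source is \<open>fob X (b w)\<close>, the product of the
    \<open>fob X (fst (w i))\<close> by \<open>Xb\<close>.\<close>
  have "\<exists>t. t \<in> Hom E (fob X (b w)) Q \<and>
      (\<forall>i\<in>?K. Comp E (\<rho> i) t = Comp E (\<iota> (A i) (w i)) (far X (p w i)))" if w: "ok w" for w
  proof -
    have "Comp E (\<iota> (A i) (w i)) (far X (p w i)) \<in> Hom E (fob X (b w)) (fob L (A i))"
      if "i \<in> ?K" for i
      using E.comp_in_Hom[OF Xp'[OF w that] \<iota>w[OF w that]] .
    then show ?thesis by (rule is_product_tuple[OF Q functor_ob[OF X bOb[OF w]]]) blast+
  qed
  then obtain t where t: "\<And>w. ok w \<Longrightarrow> t w \<in> Hom E (fob X (b w)) Q"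
    "\<And>w i. ok w \<Longrightarrow> i \<in> ?K \<Longrightarrow> Comp E (\<rho> i) (t w) = Comp E (\<iota> (A i) (w i)) (far X (p w i))"
    by metis
  let ?g = "\<lambda>w. \<iota> P (b w, \<zeta> w)"
  have g: "?g w \<in> Hom E (fob X (b w)) (fob L P)" if "ok w" for w
    using \<iota>[OF POb \<zeta>Ob[OF that]] by simp

  \<comment> \<open>The colimit property of \<open>Q\<close> in all variables at once, with
    naturality phrased by arrows of B. The target \<open>Y\<close> stays general because it is used
    for \<open>fob L P\<close>, to construct \<psi>, and for \<open>Q\<close> itself, to compare
    endomorphisms.\<close>
  have universal: "\<exists>!h. h \<in> Hom E Q Y \<and> (\<forall>w. ok w \<longrightarrow> Comp E h (t w) = g w)"
    if Y: "Y \<in> Ob E" and g: "\<And>w. ok w \<Longrightarrow> g w \<in> Hom E (fob X (b w)) Y"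
      and compat: "\<And>w w' f v. ok w \<Longrightarrow> ok w' \<Longrightarrow> v \<in> Hom B (b w) (b w') \<Longrightarrow>
        (\<And>i. i \<in> ?K \<Longrightarrow> f i \<in> Hom B (fst (w i)) (fst (w' i))) \<Longrightarrow>
        (\<And>i. i \<in> ?K \<Longrightarrow> Comp C (snd (w' i)) (far F (f i)) = snd (w i)) \<Longrightarrow>
        (\<And>i. i \<in> ?K \<Longrightarrow> Comp B (p w' i) v = Comp B (f i) (p w i)) \<Longrightarrow>
        Comp E (g w') (far X v) = g w"
    for Y g
  proof -
    \<comment> \<open>All indices vary, so \<open>S\<close> is the whole index set and the constant
      \<open>Y\<close> is a placeholder for \<open>W\<close>.\<close>
    have "product_cocone E ?K (\<lambda>i. ?J (A i)) (\<lambda>_. ?D) (\<lambda>i. fob L (A i)) (\<lambda>i. \<iota> (A i)) Y ?K (\<lambda>_. Y)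
      Q \<rho> (\<lambda>w. fob X (b w)) (\<lambda>w i. far X (p w i)) t g"
    proof (rule product_coconeI)
      show "is_product E ?K (\<lambda>i. if i \<in> ?K then fob L (A i) else Y) Q \<rho>"
        using Q is_product_cong[of ?K "\<lambda>i. fob L (A i)" "\<lambda>i. if i \<in> ?K then fob L (A i) else Y" \<rho> \<rho>] by simp
      fix w assume "\<And>i. i \<in> ?K \<Longrightarrow> w i \<in> Ob (?J (A i))"
      then have w: "ok w" by (simp add: ok_def)
      show "is_product E ?K (\<lambda>i. if i \<in> ?K then fob ?D (w i) else Y) (fob X (b w)) (\<lambda>i. far X (p w i))"
        using Xb[OF w] is_product_cong[of ?K "\<lambda>i. if i \<in> ?K then fob ?D (w i) else Y"
            "\<lambda>i. fob X (fst (w i))" "\<lambda>i. far X (p w i)" "\<lambda>i. far X (p w i)"]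
        by (simp add: fcomp_def comma_forget_def)
      show "t w \<in> Hom E (fob X (b w)) Q" "g w \<in> Hom E (fob X (b w)) Y" using w t g by auto
      show "Comp E (\<rho> i) (t w) = Comp E (\<iota> (A i) (w i)) (far X (p w i))" if "i \<in> ?K" for i
        using t(2)[OF w that] .
      fix w' u r
      assume "\<And>i. i \<in> ?K \<Longrightarrow> w' i \<in> Ob (?J (A i))"
        and u: "\<And>i. i \<in> ?K \<Longrightarrow> u i \<in> Hom (?J (A i)) (w i) (w' i)"
        and r: "r \<in> Hom E (fob X (b w)) (fob X (b w'))"
        and eq: "\<And>i. i \<in> ?K \<Longrightarrow>
          Comp E (far X (p w' i)) r = Comp E (far ?D (u i)) (far X (p w i))"
      then have w': "ok w'" by (simp add: ok_def)
      define f where "f i = fst (snd (u i))" for i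
      have f: "f i \<in> Hom B (fst (w i)) (fst (w' i))" "Comp C (snd (w' i)) (far F (f i)) = snd (w i)"
        "far ?D (u i) = far X (f i)" if "i \<in> ?K" for i
        using u[OF that] by (auto simp: Hom_comma f_def fcomp_def comma_forget_def)
      have "Comp B (f i) (p w i) \<in> Hom B (b w) (fst (w' i))" if "i \<in> ?K" for i
        using B.comp_in_Hom[OF p[OF w that] f(1)[OF that]] .
      \<comment> \<open>The arrow of B induced by the \<open>f i\<close>. As \<open>X\<close>
        preserves the product \<open>b w'\<close>, its image is determined by its components, and
        these are the components of \<open>r\<close>.\<close>
      then obtain v where v: "v \<in> Hom B (b w) (b w')"
          "\<And>i. i \<in> ?K \<Longrightarrow> Comp B (p w' i) v = Comp B (f i) (p w i)"
        using is_product_tuple[OF b[OF w'] bOb[OF w], where f = "\<lambda>i. Comp B (f i) (p w i)"] by metis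
      have "far X v = r"
      proof (rule E.is_product_ext[OF Xb[OF w'] _ r])
        show "far X v \<in> Hom E (fob X (b w)) (fob X (b w'))" using Xhom bOb w w' v(1) by blast
        fix i assume i: "i \<in> ?K"
        have "Comp E (far X (p w' i)) (far X v) = far X (Comp B (p w' i) v)"
          using functor_comp[OF X bOb[OF w] bOb[OF w'] ok_Ob(2)[OF w' i] v(1) p[OF w' i]] by simp
        also have "\<dots> = Comp E (far X (f i)) (far X (p w i))"
          using functor_comp[OF X bOb[OF w] ok_Ob(2)[OF w i] ok_Ob(2)[OF w' i] p[OF w i] f(1)[OF i]]
            v(2)[OF i] by simp
        also have "\<dots> = Comp E (far X (p w' i)) r" using eq[OF i] f(3)[OF i] by simp
        finally show "Comp E (far X (p w' i)) (far X v) = Comp E (far X (p w' i)) r" .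
      qed
      then show "Comp E (g w') r = g w" using compat[OF w w' v(1) f(1,2) v(2)] by simp
    qed simp
    moreover have "category (?J (A i))" "small_cat \<kappa> (?J (A i))" "is_functor (?J (A i)) E ?D"
      "is_colimit (?J (A i)) E ?D (fob L (A i)) (\<iota> (A i))" if "i \<in> ?K" for i
      using category_comma[OF \<open>category B\<close> \<open>category C\<close> F] small[OF AOb[OF that]]
        is_functor_fcomp[OF is_functor_comma_forget X] colim[OF AOb[OF that]] by auto
    ultimately show ?thesis
      unfolding ok_def
      by (intro product_colimit[OF \<kappa> \<open>category E\<close> fp ppc, where K = ?K and S = ?K]) (auto intro: Y)
  qed

  have "\<exists>!h. h \<in> Hom E Q (fob L P) \<and> (\<forall>w. ok w \<longrightarrow> Comp E h (t w) = ?g w)"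
  proof (rule universal[OF functor_ob[OF L POb] g])
    fix w w' f v
    assume w: "ok w" "ok w'" and v: "v \<in> Hom B (b w) (b w')"
      and f: "\<And>i. i \<in> ?K \<Longrightarrow> f i \<in> Hom B (fst (w i)) (fst (w' i))"
        "\<And>i. i \<in> ?K \<Longrightarrow> Comp C (snd (w' i)) (far F (f i)) = snd (w i)"
      and eq: "\<And>i. i \<in> ?K \<Longrightarrow> Comp B (p w' i) v = Comp B (f i) (p w i)"
    note Fv = Fhom[OF bOb[OF w(1)] bOb[OF w(2)] v]
    \<comment> \<open>This makes \<open>v\<close> an arrow of \<open>F/P\<close> from
      \<open>(b w, \<zeta> w)\<close> to \<open>(b w', \<zeta> w')\<close>, so that naturality is
      the cocone equation of \<open>\<iota> P\<close>.\<close>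
    have "Comp C (\<zeta> w') (far F v) = \<zeta> w"
    proof (rule C.is_product_ext[OF P C.comp_in_Hom[OF Fv \<zeta>(1)[OF w(2)]] \<zeta>(1)[OF w(1)]])
      fix i assume i: "i \<in> ?K"
      note Ff = Fhom[OF ok_Ob(2)[OF w(1) i] ok_Ob(2)[OF w(2) i] f(1)[OF i]]
      note hom = Fv Ff Fp[OF w(1) i] Fp[OF w(2) i] ok_Ob(3)[OF w(1) i] ok_Ob(3)[OF w(2) i]
        \<zeta>(1)[OF w(1)] \<zeta>(1)[OF w(2)] \<pi>[OF i]
      have "Comp C (\<pi> i) (Comp C (\<zeta> w') (far F v)) = Comp C (Comp C (\<pi> i) (\<zeta> w')) (far F v)"
        using hom by (simp add: C.arrow_simps)
      also have "\<dots> = Comp C (snd (w' i)) (Comp C (far F (p w' i)) (far F v))"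
        using hom by (simp add: \<zeta>(2)[OF w(2) i] C.arrow_simps)
      also have "Comp C (far F (p w' i)) (far F v) = Comp C (far F (f i)) (far F (p w i))"
        using functor_comp[OF F bOb[OF w(1)] bOb[OF w(2)] ok_Ob(2)[OF w(2) i] v p[OF w(2) i]]
          functor_comp[OF F bOb[OF w(1)] ok_Ob(2)[OF w(1) i] ok_Ob(2)[OF w(2) i] p[OF w(1) i] f(1)[OF i]]
          eq[OF i] by simp
      also have "Comp C (snd (w' i)) \<dots> = Comp C (Comp C (snd (w' i)) (far F (f i))) (far F (p w i))"
        using hom by (simp add: C.arrow_simps)
      finally show "Comp C (\<pi> i) (Comp C (\<zeta> w') (far F v)) = Comp C (\<pi> i) (\<zeta> w)"
        using f(2)[OF i] \<zeta>(2)[OF w(1) i] by simp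
    qed
    then show "Comp E (?g w') (far X v) = ?g w"
      using nat[OF POb \<zeta>Ob[OF w(1)] \<zeta>Ob[OF w(2)]] v by simp
  qed
  then obtain \<psi> where \<psi>: "\<psi> \<in> Hom E Q (fob L P)" "\<And>w. ok w \<Longrightarrow> Comp E \<psi> (t w) = ?g w" by blast

  have QOb: "Q \<in> Ob E" using Q by (rule is_product_Ob)
  \<comment> \<open>Uniqueness is what counts: \<open>Comp E \<phi> \<psi>\<close> and the identity
    both fix every \<open>t w\<close>.\<close>
  have "\<exists>!h. h \<in> Hom E Q Q \<and> (\<forall>w. ok w \<longrightarrow> Comp E h (t w) = t w)"
  proof (rule universal[OF QOb t(1)])
    fix w w' f v
    assume w: "ok w" "ok w'" and v: "v \<in> Hom B (b w) (b w')"
      and f: "\<And>i. i \<in> ?K \<Longrightarrow> f i \<in> Hom B (fst (w i)) (fst (w' i))"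
        "\<And>i. i \<in> ?K \<Longrightarrow> Comp C (snd (w' i)) (far F (f i)) = snd (w i)"
      and eq: "\<And>i. i \<in> ?K \<Longrightarrow> Comp B (p w' i) v = Comp B (f i) (p w i)"
    note Xv = Xhom[OF bOb[OF w(1)] bOb[OF w(2)] v]
    show "Comp E (t w') (far X v) = t w"
    proof (rule E.is_product_ext[OF Q E.comp_in_Hom[OF Xv t(1)[OF w(2)]] t(1)[OF w(1)]])
      fix i assume i: "i \<in> ?K"
      note Xf = Xhom[OF ok_Ob(2)[OF w(1) i] ok_Ob(2)[OF w(2) i] f(1)[OF i]]
      note hom = Xv Xf Xp'[OF w(1) i] Xp'[OF w(2) i] \<iota>w[OF w(1) i] \<iota>w[OF w(2) i]
        t(1)[OF w(1)] t(1)[OF w(2)] \<rho>[OF i]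
      have "Comp E (\<rho> i) (Comp E (t w') (far X v)) = Comp E (Comp E (\<rho> i) (t w')) (far X v)"
        using hom by (simp add: E.arrow_simps)
      also have "\<dots> = Comp E (\<iota> (A i) (w' i)) (Comp E (far X (p w' i)) (far X v))"
        using hom by (simp add: t(2)[OF w(2) i] E.arrow_simps)
      also have "Comp E (far X (p w' i)) (far X v) = Comp E (far X (f i)) (far X (p w i))"
        using functor_comp[OF X bOb[OF w(1)] bOb[OF w(2)] ok_Ob(2)[OF w(2) i] v p[OF w(2) i]]
          functor_comp[OF X bOb[OF w(1)] ok_Ob(2)[OF w(1) i] ok_Ob(2)[OF w(2) i] p[OF w(1) i] f(1)[OF i]]
          eq[OF i] by simp
      also have "Comp E (\<iota> (A i) (w' i)) \<dots> = Comp E (Comp E (\<iota> (A i) (w' i)) (far X (f i))) (far X (p w i))"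
        using hom by (simp add: E.arrow_simps)
      finally show "Comp E (\<rho> i) (Comp E (t w') (far X v)) = Comp E (\<rho> i) (t w)"
        using nat[OF AOb[OF i] ok_Ob(1)[OF w(1) i] ok_Ob(1)[OF w(2) i] f(1)[OF i] f(2)[OF i]]
          t(2)[OF w(1) i] by simp
    qed
  qed
  moreover have "Comp E (Comp E \<phi> \<psi>) (t w) = t w" if w: "ok w" for w
  proof -
    have "Comp E \<phi> (?g w) = t w"
    proof (rule E.is_product_ext[OF Q E.comp_in_Hom[OF g[OF w] \<phi>(1)] t(1)[OF w]])
      fix i assume i: "i \<in> ?K"
      have "Comp E (\<rho> i) (Comp E \<phi> (?g w)) = Comp E (Comp E (\<rho> i) \<phi>) (?g w)"
        using \<phi>(1) g[OF w] \<rho>[OF i] by (simp add: E.arrow_simps)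
      also have "\<dots> = \<iota> (A i) (b w, Comp C (snd (w i)) (far F (p w i)))"
        using \<phi>(2)[OF i] L\<iota>[OF \<pi>[OF i] \<zeta>Ob[OF w]] \<zeta>(2)[OF w i] by simp
      \<comment> \<open>\<open>p w i\<close> is an arrow of \<open>F/A i\<close> that ends at
        \<open>w i\<close> and starts at \<open>b w\<close> equipped with the composite
        arrow.\<close>
      also have "\<dots> = Comp E (\<iota> (A i) (w i)) (far X (p w i))"
        using nat[OF AOb[OF i], of "(b w, Comp C (snd (w i)) (far F (p w i)))" "w i" "p w i"]
          ok_Ob[OF w i] p[OF w i] C.comp_in_Hom[OF Fp[OF w i]] bOb[OF w] by (simp add: comma_sel)
      finally show "Comp E (\<rho> i) (Comp E \<phi> (?g w)) = Comp E (\<rho> i) (t w)"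
        using t(2)[OF w i] by simp
    qed
    then show ?thesis using \<psi>(2)[OF w] \<phi>(1) \<psi>(1) t(1)[OF w] by (simp add: E.arrow_simps)
  qed
  moreover have "Comp E (Idn E Q) (t w) = t w" if "ok w" for w
    using t(1)[OF that] by (simp add: E.arrow_simps)
  ultimately have \<phi>\<psi>: "Comp E \<phi> \<psi> = Idn E Q"
    using E.comp_in_Hom[OF \<psi>(1) \<phi>(1)] E.id_in_Hom[OF QOb] by blast

  have "Comp E (Comp E \<psi> \<phi>) (\<iota> P x) = \<iota> P x" if x: "x \<in> Ob (?J P)" for x
  proof -
    \<comment> \<open>Pushing \<open>x\<close> forward along each \<open>\<pi> i\<close> gives a
      family over the single object \<open>fst x\<close>; so \<open>b w\<close> is a power of that
      object, and \<delta> below is its diagonal.\<close>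
    define w where "w i = (fst x, Comp C (\<pi> i) (snd x))" for i
    have xB: "fst x \<in> Ob B" and xC: "snd x \<in> Hom C (fob F (fst x)) P"
      using comma_Ob_Hom[OF x] by auto
    have w: "ok w" using xB C.comp_in_Hom[OF xC \<pi>] by (simp add: ok_def w_def comma_sel)
    have fst_w: "fst (w i) = fst x" for i by (simp add: w_def)
    obtain \<delta> where \<delta>: "\<delta> \<in> Hom B (fst x) (b w)" "\<And>i. i \<in> ?K \<Longrightarrow> Comp B (p w i) \<delta> = Idn B (fst x)"
      using is_product_tuple[OF b[OF w] xB, where f = "\<lambda>_. Idn B (fst x)"] B.id_in_Hom[OF xB]
      unfolding fst_w by metis
    note F\<delta> = Fhom[OF xB bOb[OF w] \<delta>(1)] and X\<delta> = Xhom[OF xB bOb[OF w] \<delta>(1)]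
    have pw: "p w i \<in> Hom B (b w) (fst x)" if "i \<in> ?K" for i using p[OF w that] by (simp add: fst_w)
    \<comment> \<open>Hence \<delta> is an arrow of \<open>F/P\<close> from \<open>x\<close> to
      \<open>(b w, \<zeta> w)\<close>: the coprojection at \<open>x\<close> factors through one of
      those that define \<psi>.\<close>
    have "Comp C (\<zeta> w) (far F \<delta>) = snd x"
    proof (rule C.is_product_ext[OF P C.comp_in_Hom[OF F\<delta> \<zeta>(1)[OF w]] xC])
      fix i assume i: "i \<in> ?K"
      note hom = F\<delta> \<zeta>(1)[OF w] xC \<pi>[OF i] Fp[OF w i, unfolded fst_w]
      have "Comp C (\<pi> i) (Comp C (\<zeta> w) (far F \<delta>)) = Comp C (Comp C (\<pi> i) (\<zeta> w)) (far F \<delta>)"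
        using hom by (simp add: C.arrow_simps)
      also have "\<dots> = Comp C (Comp C (\<pi> i) (snd x)) (Comp C (far F (p w i)) (far F \<delta>))"
        using hom by (simp add: \<zeta>(2)[OF w i] C.arrow_simps) (simp add: w_def C.arrow_simps)
      also have "Comp C (far F (p w i)) (far F \<delta>) = Idn C (fob F (fst x))"
        using functor_comp[OF F xB bOb[OF w] xB \<delta>(1) pw[OF i]] \<delta>(2)[OF i] functor_id[OF F xB] by simp
      finally show "Comp C (\<pi> i) (Comp C (\<zeta> w) (far F \<delta>)) = Comp C (\<pi> i) (snd x)"
        using hom functor_ob[OF F xB] by (simp add: C.arrow_simps)
    qed
    then have g\<delta>: "Comp E (?g w) (far X \<delta>) = \<iota> P x"
      using nat[OF POb x \<zeta>Ob[OF w]] \<delta>(1) by simp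
    have \<iota>x: "\<iota> P x \<in> Hom E (fob X (fst x)) (fob L P)" using \<iota>[OF POb x] .
    have "Comp E \<phi> (\<iota> P x) = Comp E (t w) (far X \<delta>)"
    proof (rule E.is_product_ext[OF Q E.comp_in_Hom[OF \<iota>x \<phi>(1)] E.comp_in_Hom[OF X\<delta> t(1)[OF w]]])
      fix i assume i: "i \<in> ?K"
      note hom = X\<delta> t(1)[OF w] \<iota>x \<phi>(1) \<rho>[OF i] \<iota>w[OF w i, unfolded fst_w] Xp'[OF w i, unfolded fst_w]
      have "Comp E (\<rho> i) (Comp E (t w) (far X \<delta>)) = Comp E (Comp E (\<rho> i) (t w)) (far X \<delta>)"
        using hom by (simp add: E.arrow_simps)
      also have "\<dots> = Comp E (\<iota> (A i) (w i)) (Comp E (far X (p w i)) (far X \<delta>))"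
        using hom by (simp add: t(2)[OF w i] E.arrow_simps)
      also have "Comp E (far X (p w i)) (far X \<delta>) = Idn E (fob X (fst x))"
        using functor_comp[OF X xB bOb[OF w] xB \<delta>(1) pw[OF i]] \<delta>(2)[OF i] functor_id[OF X xB] by simp
      also have "Comp E (\<iota> (A i) (w i)) \<dots> = \<iota> (A i) (w i)" using hom by (simp add: E.arrow_simps)
      also have "\<dots> = Comp E (Comp E (\<rho> i) \<phi>) (\<iota> P x)"
        using \<phi>(2)[OF i] L\<iota>[OF \<pi>[OF i] x] by (simp add: w_def)
      also have "\<dots> = Comp E (\<rho> i) (Comp E \<phi> (\<iota> P x))" using hom by (simp add: E.arrow_simps)
      finally show "Comp E (\<rho> i) (Comp E \<phi> (\<iota> P x)) = Comp E (\<rho> i) (Comp E (t w) (far X \<delta>))" by simp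
    qed
    then have "Comp E (Comp E \<psi> \<phi>) (\<iota> P x) = Comp E (Comp E \<psi> (t w)) (far X \<delta>)"
      using \<phi>(1) \<psi>(1) \<iota>x t(1)[OF w] X\<delta> by (simp add: E.arrow_simps)
    then show ?thesis using \<psi>(2)[OF w] g\<delta> by simp
  qed
  moreover have "Comp E (Idn E (fob L P)) (\<iota> P x) = \<iota> P x" if "x \<in> Ob (?J P)" for x
    using \<iota>[OF POb that] by (simp add: E.arrow_simps)
  moreover have "\<exists>!h. h \<in> Hom E (fob L P) (fob L P) \<and> (\<forall>x\<in>Ob (?J P). Comp E h (\<iota> P x) = \<iota> P x)"
    using colim[OF POb] cocone[OF POb] unfolding is_colimit_def by blast
  ultimately have \<psi>\<phi>: "Comp E \<psi> \<phi> = Idn E (fob L P)"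
    using E.comp_in_Hom[OF \<phi>(1) \<psi>(1)] E.id_in_Hom[OF functor_ob[OF L POb]] by blast

  show "is_product E ?K (\<lambda>i. fob L (A i)) (fob L P) (\<lambda>i. far L (\<pi> i))"
    by (rule E.is_product_transport[OF Q \<phi>(1) \<psi>(1) \<phi>\<psi> \<psi>\<phi> \<phi>(2)])
qed

theorem theorem4p4:
  fixes \<kappa> :: "'u rel"
    and B :: "('bo, 'bm) cat"
    and C :: "('co, 'cm) cat"
    and E :: "('eo, 'em) cat"
    and F :: "('bo, 'bm, 'co, 'cm) fctr"
    and X :: "('bo, 'bm, 'eo, 'em) fctr"
  assumes "Cinfinite \<kappa>" and "regularCard \<kappa>"
    and "category E" and "has_finite_products E" and "has_small_colimits \<kappa> E"
    and "products_preserve_small_colimits \<kappa> E"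
    and "category C" and "locally_small_cat \<kappa> C"
    and "category B" and "small_cat \<kappa> B" and "has_finite_products B"
    and "is_functor B C F"
    and "is_functor B E X" and "preserves_finite_products B E X"
  shows "(\<exists>L \<iota>. is_left_kan_extension B C E F X L \<iota>) \<and>
         (\<forall>L \<iota>. is_left_kan_extension B C E F X L \<iota> \<longrightarrow> preserves_finite_products C E L)"
proof -
  have \<kappa>: "Card_order \<kappa>" using assms(1) by simp
  have small: "small_cat \<kappa> (comma B C F c)" if "c \<in> Ob C" for c
    using small_comma[OF assms(1,2,10,8,12) that] .
  have "\<exists>Q \<iota>. is_colimit (comma B C F c) E (fcomp X comma_forget) Q \<iota>" if "c \<in> Ob C" for c
    using small_colimit_exists[OF \<kappa> assms(5) category_comma[OF assms(9,7,12)] small[OF that]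
        is_functor_fcomp[OF is_functor_comma_forget assms(13)]] by blast
  then have "\<exists>L \<iota>. is_left_kan_extension B C E F X L \<iota>"
    by (rule kan_extension_exists[OF assms(3,7,9,12)])
  then show ?thesis
    using kan_extension_preserves_finite_products[OF \<kappa> assms(3,4,6,7,9,11,12,13,14) small] by blast
qed

end
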